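(* Let $T$ be a complete consistent first-order theory in a language $\mathcal L$, and work in $T^{\mathrm{eq}}$. For all sets $A,B,C$: $A\perp^{\text{þ}}_CB$ (thorn-forking independence defined via M-dividing) if and only if for every tuple $a\in A$, every tuple $b\in BC$ and every $\mathcal L$-formula $\varphi(x,y)$ such that $\models\varphi(a,b)$, the formula $\varphi(x,b)$ does not þ-fork over $C$ in the sense of Onshuus.
   Context: Everything is computed in a big saturated model of $T^{\mathrm{eq}}$ (so formulas and elements are those of $T^{\mathrm{eq}}$, and $\operatorname{acl}$ is $\operatorname{acl}^{\mathrm{eq}}$). All sets are small; $BC$ means $B\cup C$; $a\in A$ for a tuple $a$ means that all its entries lie in $A$. $A\equiv_BA'$ means that some automorphism fixing $B$ pointwise maps the set $A$ onto $A'$. M-dividing independence: $A\perp^M_CB$ iff $\operatorname{acl}(AC')\cap\operatorname{acl}(BC')=\operatorname{acl}C'$ for every $C'$ with $C\subseteq C'\subseteq\operatorname{acl}(BC)$. Thorn-forking independence: $A\perp^{\text{þ}}_CB$ iff for all $\hat B\supseteq B$ there is $A'\equiv_{BC}A$ such that $A'\perp^M_C\hat B$. Onshuus' definition: let $\varphi(x,y)$ be a formula without parameters, $b$ an element (or finite tuple), $C$ a set. - $\varphi(x,b)$ strongly divides over $C$ if $\operatorname{tp}(b/C)$ is not algebraic and $\{\varphi(x,b')\mid b'\models\operatorname{tp}(b/C)\}$ is $k$-inconsistent for some $k<\omega$ (i.e. for any $k$ distinct realisations $b'$ of $\operatorname{tp}(b/C)$ the corresponding formulas are jointly inconsistent;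 logically equivalent formulas with different parameters are not identified). - $\varphi(x,b)$ þ-divides over $C$ if there is a tuple $c$ such that $\varphi(x,b)$ strongly divides over $Cc$. - $\varphi(x,b)$ þ-forks over $C$ if it implies a finite disjunction of formulas (with arbitrary parameters), each of which þ-divides over $C$. *)

theory Defs
  imports Main
begin

unbundle cardinal_syntax

section \<open>Many-sorted first-order logic\<close>

text \<open>
  Variables are de Bruijn indices.  A formula is read in a context, the list of the sorts of its
  free variables; a formula \<open>\<phi>(x,y)\<close> with \<open>x\<close>, \<open>y\<close> tuples of variables of sorts \<open>X\<close>, \<open>Y\<close> is a
  formula in the context \<open>X @ Y\<close>, and \<open>\<phi>(a,b)\<close> is its evaluation under the environment \<open>a @ b\<close>.
  A one-sorted language is one whose set of sorts is a singleton.
\<close>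

datatype 'f tm = Var nat | Fn 'f "'f tm list"

datatype ('s, 'f, 'r) fm =
    Bot
  | Eq "'f tm" "'f tm"
  | Rel 'r "'f tm list"
  | Neg "('s, 'f, 'r) fm"
  | Conj "('s, 'f, 'r) fm" "('s, 'f, 'r) fm"
  | Exists 's "('s, 'f, 'r) fm"

definition Forall :: "'s \<Rightarrow> ('s, 'f, 'r) fm \<Rightarrow> ('s, 'f, 'r) fm" where
  "Forall s \<phi> = Neg (Exists s (Neg \<phi>))"

definition Iff :: "('s, 'f, 'r) fm \<Rightarrow> ('s, 'f, 'r) fm \<Rightarrow> ('s, 'f, 'r) fm" where
  "Iff \<phi> \<psi> = Conj (Neg (Conj \<phi> (Neg \<psi>))) (Neg (Conj \<psi> (Neg \<phi>)))"

text \<open>Quantification over the variables of a context prefix; index 0 is the innermost variable.\<close>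

primrec Alls :: "'s list \<Rightarrow> ('s, 'f, 'r) fm \<Rightarrow> ('s, 'f, 'r) fm" where
  "Alls [] \<phi> = \<phi>"
| "Alls (s # ss) \<phi> = Alls ss (Forall s \<phi>)"

primrec Exs :: "'s list \<Rightarrow> ('s, 'f, 'r) fm \<Rightarrow> ('s, 'f, 'r) fm" where
  "Exs [] \<phi> = \<phi>"
| "Exs (s # ss) \<phi> = Exs ss (Exists s \<phi>)"

record ('s, 'f, 'r) lang =
  Sorts :: "'s set"
  Funs :: "'f set"
  Rels :: "'r set"
  fdom :: "'f \<Rightarrow> 's list"
  fcod :: "'f \<Rightarrow> 's"
  rdom :: "'r \<Rightarrow> 's list"

definition is_lang :: "('s, 'f, 'r) lang \<Rightarrow> bool" where
  "is_lang L \<longleftrightarrow>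
     (\<forall>f\<in>Funs L. set (fdom L f) \<subseteq> Sorts L \<and> fcod L f \<in> Sorts L) \<and>
     (\<forall>r\<in>Rels L. set (rdom L r) \<subseteq> Sorts L)"

inductive has_sort :: "('s, 'f, 'r) lang \<Rightarrow> 's list \<Rightarrow> 'f tm \<Rightarrow> 's \<Rightarrow> bool"
  for L :: "('s, 'f, 'r) lang" and \<Gamma> :: "'s list" where
  "i < length \<Gamma> \<Longrightarrow> has_sort L \<Gamma> (Var i) (\<Gamma> ! i)"
| "f \<in> Funs L \<Longrightarrow> list_all2 (has_sort L \<Gamma>) ts (fdom L f) \<Longrightarrow> has_sort L \<Gamma> (Fn f ts) (fcod L f)"

fun well_sorted :: "('s, 'f, 'r) lang \<Rightarrow> 's list \<Rightarrow> ('s, 'f, 'r) fm \<Rightarrow> bool" where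
  "well_sorted L \<Gamma> Bot \<longleftrightarrow> True"
| "well_sorted L \<Gamma> (Eq t u) \<longleftrightarrow> (\<exists>s. has_sort L \<Gamma> t s \<and> has_sort L \<Gamma> u s)"
| "well_sorted L \<Gamma> (Rel r ts) \<longleftrightarrow> r \<in> Rels L \<and> list_all2 (has_sort L \<Gamma>) ts (rdom L r)"
| "well_sorted L \<Gamma> (Neg \<phi>) \<longleftrightarrow> well_sorted L \<Gamma> \<phi>"
| "well_sorted L \<Gamma> (Conj \<phi> \<psi>) \<longleftrightarrow> well_sorted L \<Gamma> \<phi> \<and> well_sorted L \<Gamma> \<psi>"
| "well_sorted L \<Gamma> (Exists s \<phi>) \<longleftrightarrow> s \<in> Sorts L \<and> well_sorted L (s # \<Gamma>) \<phi>"

definition Fm :: "('s, 'f, 'r) lang \<Rightarrow> 's list \<Rightarrow> ('s, 'f, 'r) fm set" where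
  "Fm L \<Gamma> = {\<phi>. set \<Gamma> \<subseteq> Sorts L \<and> well_sorted L \<Gamma> \<phi>}"

record ('s, 'f, 'r, 'a) struc =
  carrier :: "'s \<Rightarrow> 'a set"
  fint :: "'f \<Rightarrow> 'a list \<Rightarrow> 'a"
  rint :: "'r \<Rightarrow> 'a list \<Rightarrow> bool"

definition tuples :: "('s, 'f, 'r, 'a) struc \<Rightarrow> 's list \<Rightarrow> 'a list set" where
  "tuples M ss = {as. list_all2 (\<lambda>a s. a \<in> carrier M s) as ss}"

definition elems :: "('s, 'f, 'r) lang \<Rightarrow> ('s, 'f, 'r, 'a) struc \<Rightarrow> 'a set" where
  "elems L M = (\<Union>s\<in>Sorts L. carrier M s)"

text \<open>The sorts of a structure are nonempty and pairwise disjoint, so an element has a unique sort.\<close>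

definition is_struc :: "('s, 'f, 'r) lang \<Rightarrow> ('s, 'f, 'r, 'a) struc \<Rightarrow> bool" where
  "is_struc L M \<longleftrightarrow>
     (\<forall>s\<in>Sorts L. carrier M s \<noteq> {}) \<and>
     (\<forall>s\<in>Sorts L. \<forall>s'\<in>Sorts L. s \<noteq> s' \<longrightarrow> carrier M s \<inter> carrier M s' = {}) \<and>
     (\<forall>f\<in>Funs L. \<forall>as\<in>tuples M (fdom L f). fint M f as \<in> carrier M (fcod L f))"

primrec eval_tm :: "('s, 'f, 'r, 'a) struc \<Rightarrow> 'a list \<Rightarrow> 'f tm \<Rightarrow> 'a" where
  "eval_tm M e (Var i) = e ! i"
| "eval_tm M e (Fn f ts) = fint M f (map (eval_tm M e) ts)"

fun sat :: "('s, 'f, 'r, 'a) struc \<Rightarrow> 'a list \<Rightarrow> ('s, 'f, 'r) fm \<Rightarrow> bool" where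
  "sat M e Bot \<longleftrightarrow> False"
| "sat M e (Eq t u) \<longleftrightarrow> eval_tm M e t = eval_tm M e u"
| "sat M e (Rel r ts) \<longleftrightarrow> rint M r (map (eval_tm M e) ts)"
| "sat M e (Neg \<phi>) \<longleftrightarrow> \<not> sat M e \<phi>"
| "sat M e (Conj \<phi> \<psi>) \<longleftrightarrow> sat M e \<phi> \<and> sat M e \<psi>"
| "sat M e (Exists s \<phi>) \<longleftrightarrow> (\<exists>a\<in>carrier M s. sat M (a # e) \<phi>)"

definition is_model ::
    "('s, 'f, 'r) lang \<Rightarrow> ('s, 'f, 'r) fm set \<Rightarrow> ('s, 'f, 'r, 'a) struc \<Rightarrow> bool" where
  "is_model L T M \<longleftrightarrow> is_struc L M \<and> (\<forall>\<sigma>\<in>T. sat M [] \<sigma>)"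

text \<open>
  HOL does not allow quantification over the type of the universe, so consistency and consequence
  refer to structures whose elements are taken from the type of formulas.  That type is infinite
  and has at least as many elements as there are sorts and symbols, so by the downward
  Loewenheim-Skolem theorem every satisfiable set of sentences has a model of this kind, and
  these are the usual notions.
\<close>

type_synonym ('s, 'f, 'r) small_struc = "('s, 'f, 'r, ('s, 'f, 'r) fm) struc"

definition consistent :: "('s, 'f, 'r) lang \<Rightarrow> ('s, 'f, 'r) fm set \<Rightarrow> bool" where
  "consistent L T \<longleftrightarrow> (\<exists>M :: ('s, 'f, 'r) small_struc. is_model L T M)"

definition entails :: "('s, 'f, 'r) lang \<Rightarrow> ('s, 'f, 'r) fm set \<Rightarrow> ('s, 'f, 'r) fm \<Rightarrow> bool" where
  "entails L T \<sigma> \<longleftrightarrow> (\<forall>M :: ('s, 'f, 'r) small_struc. is_model L T M \<longrightarrow> sat M [] \<sigma>)"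

definition complete_theory :: "('s, 'f, 'r) lang \<Rightarrow> ('s, 'f, 'r) fm set \<Rightarrow> bool" where
  "complete_theory L T \<longleftrightarrow> T \<subseteq> Fm L [] \<and> (\<forall>\<sigma>\<in>Fm L []. entails L T \<sigma> \<or> entails L T (Neg \<sigma>))"


section \<open>The theory of imaginaries\<close>

text \<open>
  \<open>Imag ss E\<close> is the sort of classes of the equivalence relation \<open>E\<close> on tuples of sorts \<open>ss\<close>, and
  \<open>Proj ss E\<close> is the projection onto it.
\<close>

datatype ('s, 'f, 'r) eqsort = Home 's | Imag "'s list" "('s, 'f, 'r) fm"

datatype ('s, 'f, 'r) eqfun = Old 'f | Proj "'s list" "('s, 'f, 'r) fm"

definition eq_rels ::
    "('s, 'f, 'r) lang \<Rightarrow> ('s, 'f, 'r) fm set \<Rightarrow> ('s list \<times> ('s, 'f, 'r) fm) set" where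
  "eq_rels L T = {(ss, E). ss \<noteq> [] \<and> E \<in> Fm L (ss @ ss) \<and>
     (\<forall>M :: ('s, 'f, 'r) small_struc. is_model L T M \<longrightarrow>
        equiv (tuples M ss) {(a, b). a \<in> tuples M ss \<and> b \<in> tuples M ss \<and> sat M (a @ b) E})}"

definition eq_lang :: "('s, 'f, 'r) lang \<Rightarrow> ('s, 'f, 'r) fm set \<Rightarrow>
    (('s, 'f, 'r) eqsort, ('s, 'f, 'r) eqfun, 'r) lang" where
  "eq_lang L T = \<lparr>
     Sorts = Home ` Sorts L \<union> (\<lambda>(ss, E). Imag ss E) ` eq_rels L T,
     Funs = Old ` Funs L \<union> (\<lambda>(ss, E). Proj ss E) ` eq_rels L T,
     Rels = Rels L,
     fdom = (\<lambda>g. case g of Old f \<Rightarrow> map Home (fdom L f) | Proj ss E \<Rightarrow> map Home ss),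
     fcod = (\<lambda>g. case g of Old f \<Rightarrow> Home (fcod L f) | Proj ss E \<Rightarrow> Imag ss E),
     rdom = (\<lambda>r. map Home (rdom L r)) \<rparr>"

definition eq_embed ::
    "('s, 'f, 'r) fm \<Rightarrow> (('s, 'f, 'r) eqsort, ('s, 'f, 'r) eqfun, 'r) fm" where
  "eq_embed = map_fm Home Old id"

definition proj_vars :: "'s list \<Rightarrow> ('s, 'f, 'r) fm \<Rightarrow> nat \<Rightarrow> ('s, 'f, 'r) eqfun tm" where
  "proj_vars ss E i = Fn (Proj ss E) (map Var [i ..< i + length ss])"

definition fibre_axiom ::
    "'s list \<Rightarrow> ('s, 'f, 'r) fm \<Rightarrow> (('s, 'f, 'r) eqsort, ('s, 'f, 'r) eqfun, 'r) fm" where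
  "fibre_axiom ss E = Alls (map Home (ss @ ss))
     (Iff (eq_embed E) (Eq (proj_vars ss E 0) (proj_vars ss E (length ss))))"

definition surj_axiom ::
    "'s list \<Rightarrow> ('s, 'f, 'r) fm \<Rightarrow> (('s, 'f, 'r) eqsort, ('s, 'f, 'r) eqfun, 'r) fm" where
  "surj_axiom ss E = Forall (Imag ss E)
     (Exs (map Home ss) (Eq (proj_vars ss E 0) (Var (length ss))))"

definition eq_theory :: "('s, 'f, 'r) lang \<Rightarrow> ('s, 'f, 'r) fm set \<Rightarrow>
    (('s, 'f, 'r) eqsort, ('s, 'f, 'r) eqfun, 'r) fm set" where
  "eq_theory L T = eq_embed ` T \<union>
     (\<Union>(ss, E)\<in>eq_rels L T. {fibre_axiom ss E, surj_axiom ss E})"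


section \<open>Big saturated models\<close>

definition automorphism ::
    "('s, 'f, 'r) lang \<Rightarrow> ('s, 'f, 'r, 'a) struc \<Rightarrow> ('a \<Rightarrow> 'a) \<Rightarrow> bool" where
  "automorphism L N g \<longleftrightarrow>
     (\<forall>s\<in>Sorts L. bij_betw g (carrier N s) (carrier N s)) \<and>
     (\<forall>f\<in>Funs L. \<forall>as\<in>tuples N (fdom L f). g (fint N f as) = fint N f (map g as)) \<and>
     (\<forall>r\<in>Rels L. \<forall>as\<in>tuples N (rdom L r). rint N r (map g as) \<longleftrightarrow> rint N r as)"

definition elementary_map ::
    "('s, 'f, 'r) lang \<Rightarrow> ('s, 'f, 'r, 'a) struc \<Rightarrow> 'a set \<Rightarrow> ('a \<Rightarrow> 'a) \<Rightarrow> bool" where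
  "elementary_map L N A h \<longleftrightarrow>
     (\<forall>s\<in>Sorts L. h ` (A \<inter> carrier N s) \<subseteq> carrier N s) \<and>
     (\<forall>\<Gamma>. \<forall>\<phi>\<in>Fm L \<Gamma>. \<forall>a\<in>tuples N \<Gamma>. set a \<subseteq> A \<longrightarrow> (sat N (map h a) \<phi> \<longleftrightarrow> sat N a \<phi>))"

text \<open>
  A formula with parameters \<open>\<phi>(x,c)\<close> is represented by the pair \<open>(\<phi>, c)\<close>.
\<close>

definition Fm_over :: "('s, 'f, 'r) lang \<Rightarrow> ('s, 'f, 'r, 'a) struc \<Rightarrow> 's list \<Rightarrow> 'a set \<Rightarrow>
    (('s, 'f, 'r) fm \<times> 'a list) set" where
  "Fm_over L N X A = {(\<phi>, c). set c \<subseteq> A \<and> (\<exists>\<Gamma>. \<phi> \<in> Fm L (X @ \<Gamma>) \<and> c \<in> tuples N \<Gamma>)}"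

definition realisations :: "('s, 'f, 'r, 'a) struc \<Rightarrow> 's list \<Rightarrow>
    (('s, 'f, 'r) fm \<times> 'a list) set \<Rightarrow> 'a list set" where
  "realisations N X p = {a \<in> tuples N X. \<forall>(\<phi>, c)\<in>p. sat N (a @ c) \<phi>}"

text \<open>Sets of formulas in one variable, over fewer than \<open>\<kappa>\<close> parameters.\<close>

definition saturated ::
    "('s, 'f, 'r) lang \<Rightarrow> 'k rel \<Rightarrow> ('s, 'f, 'r, 'a) struc \<Rightarrow> bool" where
  "saturated L \<kappa> N \<longleftrightarrow>
     (\<forall>A \<subseteq> elems L N. |A| <o \<kappa> \<longrightarrow>
       (\<forall>s\<in>Sorts L. \<forall>p \<subseteq> Fm_over L N [s] A.
          (\<forall>q \<subseteq> p. finite q \<longrightarrow> realisations N [s] q \<noteq> {}) \<longrightarrow> realisations N [s] p \<noteq> {}))"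

definition strongly_homogeneous ::
    "('s, 'f, 'r) lang \<Rightarrow> 'k rel \<Rightarrow> ('s, 'f, 'r, 'a) struc \<Rightarrow> bool" where
  "strongly_homogeneous L \<kappa> N \<longleftrightarrow>
     (\<forall>A \<subseteq> elems L N. |A| <o \<kappa> \<longrightarrow>
       (\<forall>h. elementary_map L N A h \<longrightarrow> (\<exists>g. automorphism L N g \<and> (\<forall>a\<in>A. g a = h a))))"

definition big_cardinal :: "('s, 'f, 'r) lang \<Rightarrow> 'k rel \<Rightarrow> bool" where
  "big_cardinal L \<kappa> \<longleftrightarrow> Card_order \<kappa> \<and> natLeq <o \<kappa> \<and>
     |Sorts L| <o \<kappa> \<and> |Funs L| <o \<kappa> \<and> |Rels L| <o \<kappa>"

definition big_saturated_model :: "('s, 'f, 'r) lang \<Rightarrow> ('s, 'f, 'r) fm set \<Rightarrow> 'k rel \<Rightarrow>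
    ('s, 'f, 'r, 'a) struc \<Rightarrow> bool" where
  "big_saturated_model L T \<kappa> N \<longleftrightarrow>
     big_cardinal L \<kappa> \<and> is_model L T N \<and> saturated L \<kappa> N \<and> strongly_homogeneous L \<kappa> N"

definition small :: "('s, 'f, 'r) lang \<Rightarrow> 'k rel \<Rightarrow> ('s, 'f, 'r, 'a) struc \<Rightarrow> 'a set \<Rightarrow> bool" where
  "small L \<kappa> N A \<longleftrightarrow> A \<subseteq> elems L N \<and> |A| <o \<kappa>"


section \<open>Algebraic closure, types and thorn-forking\<close>

definition algebraic ::
    "('s, 'f, 'r, 'a) struc \<Rightarrow> 's list \<Rightarrow> (('s, 'f, 'r) fm \<times> 'a list) \<Rightarrow> bool" where
  "algebraic N X \<phi>c \<longleftrightarrow> finite (realisations N X {\<phi>c})"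

definition acl :: "('s, 'f, 'r) lang \<Rightarrow> ('s, 'f, 'r, 'a) struc \<Rightarrow> 'a set \<Rightarrow> 'a set" where
  "acl L N A = {e. \<exists>s\<in>Sorts L. \<exists>\<phi>c\<in>Fm_over L N [s] A.
     algebraic N [s] \<phi>c \<and> [e] \<in> realisations N [s] {\<phi>c}}"

text \<open>\<open>tp L N X a A\<close> is the type over \<open>A\<close> of the tuple \<open>a\<close> of sorts \<open>X\<close>.\<close>

definition tp :: "('s, 'f, 'r) lang \<Rightarrow> ('s, 'f, 'r, 'a) struc \<Rightarrow> 's list \<Rightarrow> 'a list \<Rightarrow> 'a set \<Rightarrow>
    (('s, 'f, 'r) fm \<times> 'a list) set" where
  "tp L N X a A = {\<phi>c \<in> Fm_over L N X A. a \<in> realisations N X {\<phi>c}}"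

definition algebraic_type ::
    "('s, 'f, 'r, 'a) struc \<Rightarrow> 's list \<Rightarrow> (('s, 'f, 'r) fm \<times> 'a list) set \<Rightarrow> bool" where
  "algebraic_type N X p \<longleftrightarrow> (\<exists>\<phi>c\<in>p. algebraic N X \<phi>c)"

text \<open>\<open>conjugate_over L N B A A'\<close> is \<open>A \<equiv>\<^sub>B A'\<close>, as sets rather than as enumerated tuples.\<close>

definition conjugate_over ::
    "('s, 'f, 'r) lang \<Rightarrow> ('s, 'f, 'r, 'a) struc \<Rightarrow> 'a set \<Rightarrow> 'a set \<Rightarrow> 'a set \<Rightarrow> bool" where
  "conjugate_over L N B A A' \<longleftrightarrow>
     (\<exists>g. automorphism L N g \<and> (\<forall>b\<in>B. g b = b) \<and> g ` A = A')"

text \<open>In both independence relations the base \<open>C\<close> is the last argument.\<close>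

definition M_indep ::
    "('s, 'f, 'r) lang \<Rightarrow> ('s, 'f, 'r, 'a) struc \<Rightarrow> 'a set \<Rightarrow> 'a set \<Rightarrow> 'a set \<Rightarrow> bool" where
  "M_indep L N A B C \<longleftrightarrow>
     (\<forall>C'. C \<subseteq> C' \<and> C' \<subseteq> acl L N (B \<union> C) \<longrightarrow>
        acl L N (A \<union> C') \<inter> acl L N (B \<union> C') = acl L N C')"

definition thorn_indep :: "('s, 'f, 'r) lang \<Rightarrow> 'k rel \<Rightarrow> ('s, 'f, 'r, 'a) struc \<Rightarrow>
    'a set \<Rightarrow> 'a set \<Rightarrow> 'a set \<Rightarrow> bool" where
  "thorn_indep L \<kappa> N A B C \<longleftrightarrow>
     (\<forall>B'. small L \<kappa> N B' \<and> B \<subseteq> B' \<longrightarrow>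
        (\<exists>A'. conjugate_over L N (B \<union> C) A A' \<and> M_indep L N A' B' C))"

text \<open>
  In the following, \<open>X\<close> and \<open>Y\<close> are the sorts of \<open>x\<close> and \<open>b\<close> in \<open>\<phi>(x,b)\<close>.  Instances of \<open>\<phi>\<close> are
  counted by their parameters, so equivalent instances with distinct parameters are distinct.
\<close>

definition strongly_divides :: "('s, 'f, 'r) lang \<Rightarrow> ('s, 'f, 'r, 'a) struc \<Rightarrow>
    's list \<Rightarrow> 's list \<Rightarrow> ('s, 'f, 'r) fm \<Rightarrow> 'a list \<Rightarrow> 'a set \<Rightarrow> bool" where
  "strongly_divides L N X Y \<phi> b C \<longleftrightarrow>
     \<not> algebraic_type N Y (tp L N Y b C) \<and>
     (\<exists>k :: nat. \<forall>D \<subseteq> realisations N Y (tp L N Y b C). finite D \<and> card D = k \<longrightarrow>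
        \<not> (\<exists>a\<in>tuples N X. \<forall>b'\<in>D. sat N (a @ b') \<phi>))"

definition thorn_divides :: "('s, 'f, 'r) lang \<Rightarrow> ('s, 'f, 'r, 'a) struc \<Rightarrow>
    's list \<Rightarrow> 's list \<Rightarrow> ('s, 'f, 'r) fm \<Rightarrow> 'a list \<Rightarrow> 'a set \<Rightarrow> bool" where
  "thorn_divides L N X Y \<phi> b C \<longleftrightarrow>
     (\<exists>c. set c \<subseteq> elems L N \<and> strongly_divides L N X Y \<phi> b (C \<union> set c))"

definition thorn_forks :: "('s, 'f, 'r) lang \<Rightarrow> ('s, 'f, 'r, 'a) struc \<Rightarrow>
    's list \<Rightarrow> 's list \<Rightarrow> ('s, 'f, 'r) fm \<Rightarrow> 'a list \<Rightarrow> 'a set \<Rightarrow> bool" where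
  "thorn_forks L N X Y \<phi> b C \<longleftrightarrow>
     (\<exists>\<Psi>. finite \<Psi> \<and>
        (\<forall>(Z, \<psi>, d)\<in>\<Psi>. \<psi> \<in> Fm L (X @ Z) \<and> d \<in> tuples N Z \<and> thorn_divides L N X Z \<psi> d C) \<and>
        (\<forall>a\<in>tuples N X. sat N (a @ b) \<phi> \<longrightarrow> (\<exists>(Z, \<psi>, d)\<in>\<Psi>. sat N (a @ d) \<psi>)))"

end

theory Submission imports Defs begin

text \<open>
  If \<open>A\<close> is independent from \<open>B\<close> over \<open>C\<close> and \<open>\<phi>(x,b)\<close> implied a disjunction of formulas
  \<open>\<psi>(x,d)\<close> strongly dividing over \<open>Cc\<close>, add all these \<open>c\<close>, \<open>d\<close> to \<open>B\<close>.  Some conjugate of \<open>a\<close>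
  satisfies one \<open>\<psi>(x,d)\<close>, and \<open>k\<close>-inconsistency makes \<open>d\<close> algebraic over \<open>aCc\<close>; so
  \<open>d \<in> acl(Cc)\<close> by M-independence, although \<open>tp(d/Cc)\<close> is not algebraic.

  Conversely, for small \<open>B' \<supseteq> B\<close>, compactness gives a realisation of \<open>tp(A/BC)\<close> that satisfies
  no formula over \<open>acl(acl(B'C))\<close> thorn-dividing over \<open>C\<close>; it is M-independent from \<open>B'\<close>, since a
  failure of M-independence is witnessed by such a formula.
\<close>

section \<open>Renaming variables and automorphisms\<close>

text \<open>The double closure arises because M-independence is tested over every \<open>C'\<close>
  inside \<open>acl(B'C)\<close>: a witness of failure lies in \<open>acl(B'C')\<close>, hence in
  \<open>acl(acl(B'C))\<close>, and no idempotence of \<open>acl\<close> has to be proved. All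
  thorn-dividing formulas with parameters in this set enter one partial type, so the set must be
  small; this is why terms and formulas are counted. The elements of \<open>A\<close> are the
  variables of that type, possibly infinitely many, whereas saturation is given for one variable at
  a time. Passing to many variables is the main obstacle. A further difference between the two sides
  is that formulas see finite tuples in a fixed order while independence speaks of sets; finite
  supports and dummy variables mediate between them, and strong homogeneity turns a realisation of
  the type into a conjugate of the set \<open>A\<close>. Every step needs some definable predicate,
  so definability is phrased for predicates on named assignments and translated to de Bruijn
  formulas only at the boundary.\<close>

primrec rename_tm :: "(nat \<Rightarrow> nat) \<Rightarrow> 'f tm \<Rightarrow> 'f tm" where
  "rename_tm f (Var i) = Var (f i)"
| "rename_tm f (Fn g ts) = Fn g (map (rename_tm f) ts)"

text \<open>Under a quantifier the bound variable keeps index 0 and the renaming of the others is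
  shifted by one.\<close>

primrec rename :: "(nat \<Rightarrow> nat) \<Rightarrow> ('s, 'f, 'r) fm \<Rightarrow> ('s, 'f, 'r) fm" where
  "rename f Bot = Bot"
| "rename f (Eq t u) = Eq (rename_tm f t) (rename_tm f u)"
| "rename f (Rel r ts) = Rel r (map (rename_tm f) ts)"
| "rename f (Neg \<phi>) = Neg (rename f \<phi>)"
| "rename f (Conj \<phi> \<psi>) = Conj (rename f \<phi>) (rename f \<psi>)"
| "rename f (Exists s \<phi>) = Exists s (rename (case_nat 0 (\<lambda>i. Suc (f i))) \<phi>)"

lemma has_sort_rename_tm:
  assumes "has_sort L \<Gamma> t s" and "\<forall>i<length \<Gamma>. f i < length \<Delta> \<and> \<Delta> ! f i = \<Gamma> ! i"
  shows "has_sort L \<Delta> (rename_tm f t) s"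
  using assms(1)
proof induction
  case (1 i)
  then show ?case using assms(2) has_sort.intros(1)[of "f i" \<Delta> L] by auto
next
  case (2 g ts)
  have "list_all2 (has_sort L \<Delta>) (map (rename_tm f) ts) (fdom L g)"
    using "2.IH" by (auto simp: list_all2_conv_all_nth)
  then show ?case using "2.hyps" by (auto intro: has_sort.intros)
qed

lemma eval_tm_rename_tm:
  assumes "has_sort L \<Gamma> t s" and "\<forall>i<length \<Gamma>. e' ! f i = e ! i"
  shows "eval_tm M e' (rename_tm f t) = eval_tm M e t"
  using assms(1)
proof induction
  case (2 g ts)
  have "map (eval_tm M e' \<circ> rename_tm f) ts = map (eval_tm M e) ts"
    using "2.IH" by (auto simp: list_all2_conv_all_nth in_set_conv_nth)
  then show ?case by (simp only: rename_tm.simps eval_tm.simps map_map)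
qed (use assms(2) in auto)

lemma well_sorted_rename:
  assumes "well_sorted L \<Gamma> \<phi>" and "\<forall>i<length \<Gamma>. f i < length \<Delta> \<and> \<Delta> ! f i = \<Gamma> ! i"
  shows "well_sorted L \<Delta> (rename f \<phi>)"
  using assms
proof (induction \<phi> arbitrary: \<Gamma> \<Delta> f)
  case (Exists s \<phi>)
  have "\<forall>i<length (s # \<Gamma>). case_nat 0 (\<lambda>i. Suc (f i)) i < length (s # \<Delta>) \<and>
     (s # \<Delta>) ! case_nat 0 (\<lambda>i. Suc (f i)) i = (s # \<Gamma>) ! i"
    using Exists.prems(2) by (auto simp: less_Suc_eq_0_disj)
  then show ?case using Exists.IH[of "s # \<Gamma>"] Exists.prems(1) by simp
next
  case (Rel r ts)
  then show ?case using has_sort_rename_tm[OF _ Rel.prems(2), of L]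
    by (auto simp: list_all2_conv_all_nth)
next
  case (Eq t u)
  then show ?case using has_sort_rename_tm[OF _ Eq.prems(2), of L] by auto
next
  case (Neg \<phi>)
  then show ?case by simp
next
  case (Conj \<phi> \<psi>)
  show ?case using Conj.IH[OF _ Conj.prems(2)] Conj.prems(1) by auto
qed simp

lemma sat_rename:
  assumes "well_sorted L \<Gamma> \<phi>" and "\<forall>i<length \<Gamma>. e' ! f i = e ! i"
  shows "sat M e' (rename f \<phi>) \<longleftrightarrow> sat M e \<phi>"
  using assms
proof (induction \<phi> arbitrary: \<Gamma> e e' f)
  case (Exists s \<phi>)
  have "\<forall>i<length (s # \<Gamma>). (a # e') ! case_nat 0 (\<lambda>i. Suc (f i)) i = (a # e) ! i" for a
    using Exists.prems(2) by (auto simp: less_Suc_eq_0_disj)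
  then have "sat M (a # e') (rename (case_nat 0 (\<lambda>i. Suc (f i))) \<phi>) \<longleftrightarrow> sat M (a # e) \<phi>" for a
    using Exists.prems(1) by (intro Exists.IH[of "s # \<Gamma>"]) auto
  then show ?case by simp
next
  case (Rel r ts)
  have "map (eval_tm M e' \<circ> rename_tm f) ts = map (eval_tm M e) ts"
  proof (rule nth_equalityI)
    fix i assume "i < length (map (eval_tm M e' \<circ> rename_tm f) ts)"
    then have "has_sort L \<Gamma> (ts ! i) (rdom L r ! i)"
      using Rel.prems(1) by (simp add: list_all2_conv_all_nth)
    from eval_tm_rename_tm[OF this Rel.prems(2)]
    show "map (eval_tm M e' \<circ> rename_tm f) ts ! i = map (eval_tm M e) ts ! i"
      using \<open>i < _\<close> by simp
  qed simp
  then show ?case by (simp only: rename.simps sat.simps map_map)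
next
  case (Eq t u)
  then obtain s where "has_sort L \<Gamma> t s" "has_sort L \<Gamma> u s" by auto
  then show ?case by (simp add: eval_tm_rename_tm[OF _ Eq.prems(2)])
next
  case (Conj \<phi> \<psi>)
  show ?case using Conj.IH[OF _ Conj.prems(2)] Conj.prems(1) by auto
next
  case (Neg \<phi>)
  show ?case using Neg.IH[OF _ Neg.prems(2)] Neg.prems(1) by auto
qed simp

text \<open>Labels name the positions of a context, and one formula \<open>\<phi>'\<close> serves
  every assignment \<open>\<eta>\<close> of elements to labels. Permuting variables, merging
  repeated ones and adding dummy ones are all instances.\<close>

lemma rename_variables:
  fixes M :: "('s, 'f, 'r, 'a) struc"
  assumes "\<phi> \<in> Fm L (map \<tau> ws)" and "set ws \<subseteq> set ws'" and "\<tau> ` set ws' \<subseteq> Sorts L"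
  obtains \<phi>' where "\<phi>' \<in> Fm L (map \<tau> ws')"
    and "\<And>\<eta>. sat M (map \<eta> ws') \<phi>' \<longleftrightarrow> sat M (map \<eta> ws) \<phi>"
proof -
  have "\<forall>i<length ws. \<exists>j<length ws'. ws' ! j = ws ! i"
    using assms(2) by (metis in_set_conv_nth subset_eq)
  then obtain f where f: "\<forall>i<length ws. f i < length ws' \<and> ws' ! f i = ws ! i"
    by metis
  show ?thesis
  proof
    show "rename f \<phi> \<in> Fm L (map \<tau> ws')"
      using assms(1,3) f well_sorted_rename[of L "map \<tau> ws" \<phi> f "map \<tau> ws'"] by (auto simp: Fm_def)
    show "sat M (map \<eta> ws') (rename f \<phi>) \<longleftrightarrow> sat M (map \<eta> ws) \<phi>" for \<eta>
      using assms(1) f by (intro sat_rename[of L "map \<tau> ws"]) (auto simp: Fm_def)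
  qed
qed

section \<open>Invariance of satisfaction under automorphisms\<close>

lemma eval_tm_in_carrier:
  assumes "is_struc L M" and "has_sort L \<Gamma> t s" and "e \<in> tuples M \<Gamma>"
  shows "eval_tm M e t \<in> carrier M s"
  using assms(2)
proof induction
  case (1 i)
  then show ?case using assms(3) by (auto simp: tuples_def list_all2_conv_all_nth)
next
  case (2 g ts)
  have "map (eval_tm M e) ts \<in> tuples M (fdom L g)"
    using "2.IH" by (auto simp: tuples_def list_all2_conv_all_nth)
  then show ?case using assms(1) "2.hyps" by (auto simp: is_struc_def)
qed

lemma has_sort_in_Sorts:
  assumes "is_lang L" and "has_sort L \<Gamma> t s" and "set \<Gamma> \<subseteq> Sorts L"
  shows "s \<in> Sorts L"
  using assms(2,1,3) by cases (auto simp: is_lang_def)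

lemma eval_tm_automorphism:
  assumes "is_struc L M" and "automorphism L M g" and "e \<in> tuples M \<Gamma>" and "has_sort L \<Gamma> t s"
  shows "eval_tm M (map g e) t = g (eval_tm M e t)"
  using assms(4)
proof induction
  case (1 i)
  then show ?case using assms(3) by (auto simp: tuples_def list_all2_conv_all_nth)
next
  case (2 h ts)
  have "map (eval_tm M e) ts \<in> tuples M (fdom L h)"
    using "2.IH" eval_tm_in_carrier[OF assms(1) _ assms(3)]
    by (auto simp: tuples_def list_all2_conv_all_nth)
  moreover have "map (eval_tm M (map g e)) ts = map g (map (eval_tm M e) ts)"
    using "2.IH" by (auto simp: list_all2_conv_all_nth in_set_conv_nth)
  ultimately show ?case
    using assms(2) "2.hyps" by (simp add: automorphism_def del: map_map map_eq_conv)
qed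

lemma tuples_map_automorphism:
  assumes "automorphism L M g" and "e \<in> tuples M \<Gamma>" and "set \<Gamma> \<subseteq> Sorts L"
  shows "map g e \<in> tuples M \<Gamma>"
proof -
  have "\<And>s a. s \<in> Sorts L \<Longrightarrow> a \<in> carrier M s \<Longrightarrow> g a \<in> carrier M s"
    using assms(1) by (auto simp: automorphism_def bij_betw_def)
  moreover have "\<Gamma> ! i \<in> Sorts L" if "i < length \<Gamma>" for i
    using assms(3) that nth_mem by blast
  ultimately show ?thesis using assms(2) by (auto simp: tuples_def list_all2_conv_all_nth)
qed

text \<open>Equality needs \<open>g\<close> to be injective, which is known only on each carrier;
  well-sortedness puts both terms into one. The quantifier step needs surjectivity on the
  carrier.\<close>

lemma sat_automorphism:
  assumes "is_lang L" and "is_struc L M" and "automorphism L M g"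
    and "e \<in> tuples M \<Gamma>" and "set \<Gamma> \<subseteq> Sorts L" and "well_sorted L \<Gamma> \<phi>"
  shows "sat M (map g e) \<phi> \<longleftrightarrow> sat M e \<phi>"
  using assms(4-)
proof (induction \<phi> arbitrary: \<Gamma> e)
  case (Eq t u)
  then obtain s where s: "has_sort L \<Gamma> t s" "has_sort L \<Gamma> u s" by auto
  then have "s \<in> Sorts L" using has_sort_in_Sorts assms(1) Eq.prems(2) by metis
  then have "inj_on g (carrier M s)" using assms(3) by (auto simp: automorphism_def bij_betw_def)
  then show ?case
    using s eval_tm_automorphism[OF assms(2,3) Eq.prems(1)]
      eval_tm_in_carrier[OF assms(2) _ Eq.prems(1)] by (auto dest: inj_onD)
next
  case (Rel r ts)
  have "map (eval_tm M e) ts \<in> tuples M (rdom L r)"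
    using Rel.prems eval_tm_in_carrier[OF assms(2) _ Rel.prems(1)]
    by (auto simp: tuples_def list_all2_conv_all_nth)
  moreover have "map (eval_tm M (map g e)) ts = map g (map (eval_tm M e) ts)"
  proof (rule nth_equalityI)
    fix i assume "i < length (map (eval_tm M (map g e)) ts)"
    then have "has_sort L \<Gamma> (ts ! i) (rdom L r ! i)"
      using Rel.prems(3) by (simp add: list_all2_conv_all_nth)
    from eval_tm_automorphism[OF assms(2,3) Rel.prems(1) this]
    show "map (eval_tm M (map g e)) ts ! i = map g (map (eval_tm M e) ts) ! i"
      using \<open>i < _\<close> by simp
  qed simp
  ultimately show ?case
    using assms(3) Rel.prems(3) by (simp add: automorphism_def del: map_map map_eq_conv)
next
  case (Exists s \<phi>)
  then have "bij_betw g (carrier M s) (carrier M s)"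
    using assms(3) by (auto simp: automorphism_def)
  then have "(\<exists>a\<in>carrier M s. sat M (a # map g e) \<phi>) \<longleftrightarrow>
      (\<exists>a\<in>carrier M s. sat M (map g (a # e)) \<phi>)"
    by (metis (no_types, lifting) bij_betw_def image_iff list.simps(9))
  also have "\<dots> \<longleftrightarrow> (\<exists>a\<in>carrier M s. sat M (a # e) \<phi>)"
    using Exists.prems by (intro bex_cong refl Exists.IH[of _ "s # \<Gamma>"]) (auto simp: tuples_def)
  finally show ?case by simp
qed auto

text \<open>This turns tuples back into assignments. The default \<open>\<rho>0\<close> makes it
  possible to stay well-sorted on variables outside \<open>vs\<close>.\<close>

lemma ex_assignment:
  assumes "distinct vs" and "length t = length vs"
  obtains \<rho> where "map \<rho> vs = t" and "\<And>v. v \<notin> set vs \<Longrightarrow> \<rho> v = \<rho>0 v"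
proof
  let ?\<rho> = "\<lambda>v. case map_of (zip vs t) v of Some y \<Rightarrow> y | None \<Rightarrow> \<rho>0 v"
  show "map ?\<rho> vs = t" using assms by (intro nth_equalityI) (auto simp: map_of_zip_nth)
  show "?\<rho> v = \<rho>0 v" if v: "v \<notin> set vs" for v
  proof -
    have "map_of (zip vs t) v = None" using v by (auto simp: map_of_eq_None_iff dest: set_zip_leftD)
    then show ?thesis by simp
  qed
qed

section \<open>Counting formulas\<close>

lemma card_of_image_ordLeq: "|A| \<le>o r \<Longrightarrow> |f ` A| \<le>o r"
  using card_of_image ordLeq_transitive by blast

lemma card_of_subset_ordLeq: "|B| \<le>o r \<Longrightarrow> A \<subseteq> B \<Longrightarrow> |A| \<le>o r"
  using card_of_mono1 ordLeq_transitive by blast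

lemma card_of_UN_nat_ordLeq:
  assumes "infinite U" and "\<And>n :: nat. |A n| \<le>o |U|"
  shows "|\<Union>n. A n| \<le>o |U|"
  using assms by (intro card_of_UNION_ordLeq_infinite) (auto simp: infinite_iff_card_of_nat)

lemma card_of_Un_ordLeq: "infinite U \<Longrightarrow> |A| \<le>o |U| \<Longrightarrow> |B| \<le>o |U| \<Longrightarrow> |A \<union> B| \<le>o |U|"
  by (rule card_of_Un_ordLeq_infinite_Field[OF _ _ _ card_of_Card_order]) (simp_all add: Field_card_of)

lemma card_of_Times_ordLeq: "infinite U \<Longrightarrow> |A| \<le>o |U| \<Longrightarrow> |B| \<le>o |U| \<Longrightarrow> |A \<times> B| \<le>o |U|"
  by (rule card_of_Times_ordLeq_infinite_Field[OF _ _ _ card_of_Card_order]) (simp_all add: Field_card_of)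

lemma card_of_finite_ordLeq: "infinite U \<Longrightarrow> finite A \<Longrightarrow> |A| \<le>o |U|"
  using ordLeq_total[OF card_of_Well_order card_of_Well_order, of A U] card_of_ordLeq_finite[of U A]
  by auto

lemma card_of_lists_ordLeq:
  assumes U: "infinite U" and X: "|X| \<le>o |U|"
  shows "|lists X| \<le>o |U|"
proof -
  have "|{xs \<in> lists X. length xs = n}| \<le>o |U|" for n
  proof (induction n)
    case 0
    have "{xs \<in> lists X. length xs = 0} = {[]}" by auto
    then show ?case using card_of_finite_ordLeq[OF U finite.insertI[OF finite.emptyI]] by (simp only:)
  next
    case (Suc n)
    have "{xs \<in> lists X. length xs = Suc n} \<subseteq>
        (\<lambda>(x, xs). x # xs) ` (X \<times> {xs \<in> lists X. length xs = n})"
      by (auto simp: length_Suc_conv image_iff)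
    then show ?case
      by (rule card_of_subset_ordLeq[rotated])
        (intro card_of_image_ordLeq card_of_Times_ordLeq U X Suc)
  qed
  then have "|\<Union>n. {xs \<in> lists X. length xs = n}| \<le>o |U|"
    by (rule card_of_UN_nat_ordLeq[OF U])
  then show ?thesis by (rule card_of_subset_ordLeq) auto
qed

text \<open>The type of terms may be larger than the language, so only terms over
  \<open>Funs L\<close> are counted. The stage \<open>D n\<close> ignores arities and sorts; it
  contains every well-sorted term of size below \<open>n\<close>.\<close>

lemma card_of_terms:
  assumes U: "infinite U" and F: "|Funs L| \<le>o |U|"
  shows "|{t. \<exists>\<Gamma> s. has_sort L \<Gamma> t s}| \<le>o |U|"
proof -
  define D where "D = rec_nat {} (\<lambda>_ D. range Var \<union> (\<lambda>(f, ts). Fn f ts) ` (Funs L \<times> lists D))"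
  have D: "D 0 = {}" "D (Suc n) = range Var \<union> (\<lambda>(f, ts). Fn f ts) ` (Funs L \<times> lists (D n))" for n
    by (simp_all add: D_def)
  have N: "|UNIV :: nat set| \<le>o |U|" using U infinite_iff_card_of_nat by blast
  have "|D n| \<le>o |U|" for n
  proof (induction n)
    case (Suc n)
    then show ?case unfolding D
      by (intro card_of_Un_ordLeq card_of_image_ordLeq card_of_Times_ordLeq card_of_lists_ordLeq U F N)
  qed (simp add: D card_of_finite_ordLeq[OF U])
  then have le: "|\<Union>n. D n| \<le>o |U|" by (rule card_of_UN_nat_ordLeq[OF U])
  have "t \<in> D n" if "has_sort L \<Gamma> t s" "size t < n" for t \<Gamma> s n
    using that
  proof (induction n arbitrary: t s)
    case (Suc n)
    from Suc.prems(1) show ?case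
    proof cases
      case (2 f ts)
      have "u \<in> D n" if u: "u \<in> set ts" for u
      proof -
        obtain s' where "has_sort L \<Gamma> u s'"
          using 2(4) u by (metis in_set_conv_nth list_all2_conv_all_nth)
        moreover have "size u < n"
          using Suc.prems(2) 2(1) size_list_estimation'[OF u order_refl, of size] by simp
        ultimately show ?thesis by (rule Suc.IH)
      qed
      then show ?thesis using 2 by (auto simp: D image_iff)
    qed (simp add: D)
  qed simp
  then have "{t. \<exists>\<Gamma> s. has_sort L \<Gamma> t s} \<subseteq> (\<Union>n. D n)" by blast
  then show ?thesis by (rule card_of_subset_ordLeq[OF le])
qed

text \<open>The stages are again free of contexts. Since a quantifier enlarges the context, the
  formulas of all contexts are bounded at once.\<close>

lemma card_of_formulas:
  fixes L :: "('s, 'f, 'r) lang"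
  assumes U: "infinite U" and F: "|Funs L| \<le>o |U|" and R: "|Rels L| \<le>o |U|" and S: "|Sorts L| \<le>o |U|"
  shows "|{\<phi>. \<exists>\<Gamma>. well_sorted L \<Gamma> \<phi>}| \<le>o |U|"
proof -
  let ?T = "{t. \<exists>\<Gamma> s. has_sort L \<Gamma> t s}"
  have T: "|?T| \<le>o |U|" by (rule card_of_terms[OF U F])
  define D where "D = rec_nat {} (\<lambda>_ D. {Bot} \<union> (\<lambda>(t, u). Eq t u) ` (?T \<times> ?T) \<union>
    (\<lambda>(r, ts). Rel r ts) ` (Rels L \<times> lists ?T) \<union> Neg ` D \<union> (\<lambda>(\<phi>, \<psi>). Conj \<phi> \<psi>) ` (D \<times> D) \<union>
    (\<lambda>(s, \<phi>). Exists s \<phi>) ` (Sorts L \<times> D))"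
  have D: "D 0 = {}" "D (Suc n) = {Bot} \<union> (\<lambda>(t, u). Eq t u) ` (?T \<times> ?T) \<union>
    (\<lambda>(r, ts). Rel r ts) ` (Rels L \<times> lists ?T) \<union> Neg ` D n \<union> (\<lambda>(\<phi>, \<psi>). Conj \<phi> \<psi>) ` (D n \<times> D n) \<union>
    (\<lambda>(s, \<phi>). Exists s \<phi>) ` (Sorts L \<times> D n)" for n
    by (simp_all add: D_def)
  have B: "|{Bot :: ('s, 'f, 'r) fm}| \<le>o |U|" by (rule card_of_finite_ordLeq[OF U]) simp
  have "|D n| \<le>o |U|" for n
  proof (induction n)
    case (Suc n)
    then show ?case unfolding D
      by (intro card_of_Un_ordLeq card_of_image_ordLeq card_of_Times_ordLeq card_of_lists_ordLeq U T R S B)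
  qed (simp add: D card_of_finite_ordLeq[OF U])
  then have le: "|\<Union>n. D n| \<le>o |U|" by (rule card_of_UN_nat_ordLeq[OF U])
  have "\<phi> \<in> D n" if "well_sorted L \<Gamma> \<phi>" "size \<phi> < n" for \<phi> \<Gamma> n
    using that
  proof (induction n arbitrary: \<phi> \<Gamma>)
    case (Suc n)
    show ?case
    proof (cases \<phi>)
      case (Rel r ts)
      have "\<exists>s. has_sort L \<Gamma> t s" if "t \<in> set ts" for t
        using Suc.prems(1) Rel that by (metis in_set_conv_nth list_all2_conv_all_nth well_sorted.simps(3))
      then have "ts \<in> lists ?T" by blast
      then show ?thesis using Suc.prems(1) Rel by (auto simp: D image_iff)
    next
      case (Conj \<psi> \<chi>)
      then show ?thesis using Suc.prems Suc.IH[of \<Gamma> \<psi>] Suc.IH[of \<Gamma> \<chi>] by (simp add: D image_iff)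
    next
      case (Neg \<psi>)
      then show ?thesis using Suc.prems Suc.IH[of \<Gamma> \<psi>] by (simp add: D)
    next
      case (Exists s \<psi>)
      then show ?thesis using Suc.prems Suc.IH[of "s # \<Gamma>" \<psi>] by (simp add: D image_iff)
    next
      case (Eq t u)
      then show ?thesis using Suc.prems by (auto simp: D image_iff)
    qed (simp add: D)
  qed simp
  then have "{\<phi>. \<exists>\<Gamma>. well_sorted L \<Gamma> \<phi>} \<subseteq> (\<Union>n. D n)" by blast
  then show ?thesis by (rule card_of_subset_ordLeq[OF le])
qed

section \<open>Definable predicates on assignments\<close>

text \<open>The argument is run in a monster model of an arbitrary many-sorted language; imaginaries
  return when the locale is interpreted.\<close>

locale monster_model =
  fixes L :: "('s, 'f, 'r) lang" and \<kappa> :: "'k rel" and N :: "('s, 'f, 'r, 'a) struc"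
  assumes lang: "is_lang L" and struc: "is_struc L N" and big: "big_cardinal L \<kappa>"
    and saturated: "saturated L \<kappa> N" and homogeneous: "strongly_homogeneous L \<kappa> N"
begin

text \<open>The carriers are pairwise disjoint, so on \<open>elems L N\<close> the choice is forced
  and a tuple determines its own context.\<close>

definition sort_of :: "'a \<Rightarrow> 's" where
  "sort_of a = (SOME s. s \<in> Sorts L \<and> a \<in> carrier N s)"

lemma sort_of:
  assumes "a \<in> elems L N"
  shows "sort_of a \<in> Sorts L" and "a \<in> carrier N (sort_of a)"
  using assms someI_ex[of "\<lambda>s. s \<in> Sorts L \<and> a \<in> carrier N s"]
  unfolding sort_of_def elems_def by auto

lemma sort_of_eq: "s \<in> Sorts L \<Longrightarrow> a \<in> carrier N s \<Longrightarrow> sort_of a = s"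
  using sort_of[of a] struc unfolding is_struc_def elems_def by blast

lemma in_elems: "s \<in> Sorts L \<Longrightarrow> a \<in> carrier N s \<Longrightarrow> a \<in> elems L N"
  by (auto simp: elems_def)

lemma carrier_nonempty: "s \<in> Sorts L \<Longrightarrow> \<exists>a. a \<in> carrier N s"
  using struc by (auto simp: is_struc_def)

lemma tuples_map_iff:
  "map \<eta> ws \<in> tuples N (map \<tau> ws) \<longleftrightarrow> (\<forall>w\<in>set ws. \<eta> w \<in> carrier N (\<tau> w))"
  by (simp add: tuples_def list_all2_map1 list_all2_map2 list.rel_refl_strong list_all2_same)

lemma tuples_append: "length a = length X \<Longrightarrow>
    a @ b \<in> tuples N (X @ Y) \<longleftrightarrow> a \<in> tuples N X \<and> b \<in> tuples N Y"
  by (simp add: tuples_def list_all2_append)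

lemma length_tuples: "a \<in> tuples N X \<Longrightarrow> length a = length X"
  by (auto simp: tuples_def list_all2_lengthD)

lemma tuples_sorts:
  assumes "a \<in> tuples N X" and "set X \<subseteq> Sorts L"
  shows "X = map sort_of a" and "set a \<subseteq> elems L N"
proof -
  have "a ! i \<in> carrier N (X ! i) \<and> X ! i \<in> Sorts L" if "i < length X" for i
    using assms that nth_mem[OF that] by (auto simp: tuples_def list_all2_conv_all_nth)
  then show "X = map sort_of a" "set a \<subseteq> elems L N"
    using length_tuples[OF assms(1)] sort_of_eq in_elems
    by (auto intro!: nth_equalityI simp: in_set_conv_nth) metis+
qed

lemma tuples_sort_of: "set a \<subseteq> elems L N \<Longrightarrow> a \<in> tuples N (map sort_of a)"
  using sort_of tuples_map_iff[of id a sort_of] by auto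

text \<open>Assignments are total functions, unconstrained outside \<open>V\<close>. An assignment
  can thus be updated or reused for other variable sets without a change of type.\<close>

definition Env :: "('v \<Rightarrow> 's) \<Rightarrow> 'v set \<Rightarrow> ('v \<Rightarrow> 'a) set" where
  "Env srt V = {\<rho>. \<forall>v\<in>V. \<rho> v \<in> carrier N (srt v)}"

text \<open>
  \<open>P\<close> is definable over \<open>A\<close> with free variables in \<open>V\<close>.  The positions of the formula are labelled
  by variables \<open>Inl v\<close> and parameters \<open>Inr a\<close> in arbitrary order, which hides de Bruijn indices
  from the closure properties.
\<close>

definition dfn :: "('v \<Rightarrow> 's) \<Rightarrow> 'v set \<Rightarrow> 'a set \<Rightarrow> (('v \<Rightarrow> 'a) \<Rightarrow> bool) \<Rightarrow> bool" where
  "dfn srt V A P \<longleftrightarrow> (\<exists>ws \<phi>. set ws \<subseteq> V <+> A \<and> \<phi> \<in> Fm L (map (case_sum srt sort_of) ws) \<and>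
     (\<forall>\<rho>\<in>Env srt V. P \<rho> \<longleftrightarrow> sat N (map (case_sum \<rho> id) ws) \<phi>))"

lemma dfnI:
  assumes "set ws \<subseteq> V <+> A" and "\<phi> \<in> Fm L (map (case_sum srt sort_of) ws)"
    and "\<And>\<rho>. \<rho> \<in> Env srt V \<Longrightarrow> P \<rho> \<longleftrightarrow> sat N (map (case_sum \<rho> id) ws) \<phi>"
  shows "dfn srt V A P"
  using assms unfolding dfn_def by blast

lemma dfn_cong:
  assumes "dfn srt V A P" and "\<And>\<rho>. \<rho> \<in> Env srt V \<Longrightarrow> P \<rho> \<longleftrightarrow> Q \<rho>"
  shows "dfn srt V A Q"
  using assms unfolding dfn_def by fastforce

lemma dfn_mono:
  assumes "dfn srt V A P" and "V \<subseteq> V'" and "A \<subseteq> A'"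
  shows "dfn srt V' A' P"
proof -
  have "Env srt V' \<subseteq> Env srt V" using assms(2) by (auto simp: Env_def)
  moreover have "V <+> A \<subseteq> V' <+> A'" using assms by auto
  ultimately show ?thesis using assms(1) unfolding dfn_def by blast
qed

lemma dfn_True: "dfn srt V A (\<lambda>\<rho>. True)"
  by (rule dfnI[of "[]" _ _ "Neg Bot"]) (auto simp: Fm_def)

lemma dfn_neg:
  assumes "dfn srt V A P"
  shows "dfn srt V A (\<lambda>\<rho>. \<not> P \<rho>)"
proof -
  obtain ws \<phi> where "set ws \<subseteq> V <+> A" "\<phi> \<in> Fm L (map (case_sum srt sort_of) ws)"
    "\<forall>\<rho>\<in>Env srt V. P \<rho> \<longleftrightarrow> sat N (map (case_sum \<rho> id) ws) \<phi>"
    using assms unfolding dfn_def by blast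
  then show ?thesis by (intro dfnI[of ws _ _ "Neg \<phi>"]) (auto simp: Fm_def)
qed

lemma dfn_conj:
  assumes "dfn srt V A P" and "dfn srt V A Q"
  shows "dfn srt V A (\<lambda>\<rho>. P \<rho> \<and> Q \<rho>)"
proof -
  let ?\<tau> = "case_sum srt sort_of"
  obtain ws \<phi> where P: "set ws \<subseteq> V <+> A" "\<phi> \<in> Fm L (map ?\<tau> ws)"
    "\<forall>\<rho>\<in>Env srt V. P \<rho> \<longleftrightarrow> sat N (map (case_sum \<rho> id) ws) \<phi>"
    using assms(1) unfolding dfn_def by blast
  obtain us \<psi> where Q: "set us \<subseteq> V <+> A" "\<psi> \<in> Fm L (map ?\<tau> us)"
    "\<forall>\<rho>\<in>Env srt V. Q \<rho> \<longleftrightarrow> sat N (map (case_sum \<rho> id) us) \<psi>"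
    using assms(2) unfolding dfn_def by blast
  have S: "?\<tau> ` set (ws @ us) \<subseteq> Sorts L" using P(2) Q(2) by (auto simp: Fm_def)
  obtain \<phi>' where \<phi>': "\<phi>' \<in> Fm L (map ?\<tau> (ws @ us))"
    "\<And>\<eta>. sat N (map \<eta> (ws @ us)) \<phi>' \<longleftrightarrow> sat N (map \<eta> ws) \<phi>"
    by (rule rename_variables[where M = N, OF P(2) _ S]) (auto intro: that)
  obtain \<psi>' where \<psi>': "\<psi>' \<in> Fm L (map ?\<tau> (ws @ us))"
    "\<And>\<eta>. sat N (map \<eta> (ws @ us)) \<psi>' \<longleftrightarrow> sat N (map \<eta> us) \<psi>"
    by (rule rename_variables[where M = N, OF Q(2) _ S]) (auto intro: that)
  show ?thesis
  proof (rule dfnI)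
    show "set (ws @ us) \<subseteq> V <+> A" using P Q by auto
    show "Conj \<phi>' \<psi>' \<in> Fm L (map ?\<tau> (ws @ us))" using \<phi>' \<psi>' by (simp add: Fm_def)
  qed (simp only: P Q \<phi>' \<psi>' sat.simps)
qed

lemma dfn_Ball:
  assumes "finite I" and "\<And>i. i \<in> I \<Longrightarrow> dfn srt V A (P i)"
  shows "dfn srt V A (\<lambda>\<rho>. \<forall>i\<in>I. P i \<rho>)"
  using assms
proof (induction I)
  case empty
  show ?case using dfn_True by (rule dfn_cong) simp
next
  case (insert i I)
  then have "dfn srt V A (\<lambda>\<rho>. P i \<rho> \<and> (\<forall>i\<in>I. P i \<rho>))" by (intro dfn_conj) auto
  then show ?case by (rule dfn_cong) simp
qed

text \<open>A formula has finitely many labels. Since \<open>P\<close> may be arbitrary off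
  \<open>Env srt V\<close>, dependence on \<open>W\<close> alone is claimed for the predicate
  \<open>Q\<close> that the formula defines.\<close>

lemma dfn_finite_support:
  assumes "dfn srt V A P"
  obtains W Q where "finite W" and "W \<subseteq> V" and "dfn srt W A Q"
    and "\<And>\<rho>. \<rho> \<in> Env srt V \<Longrightarrow> P \<rho> \<longleftrightarrow> Q \<rho>"
    and "\<And>\<rho> \<rho>'. \<forall>v\<in>W. \<rho> v = \<rho>' v \<Longrightarrow> Q \<rho> \<longleftrightarrow> Q \<rho>'"
proof -
  obtain ws \<phi> where P: "set ws \<subseteq> V <+> A" "\<phi> \<in> Fm L (map (case_sum srt sort_of) ws)"
    "\<forall>\<rho>\<in>Env srt V. P \<rho> \<longleftrightarrow> sat N (map (case_sum \<rho> id) ws) \<phi>"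
    using assms unfolding dfn_def by blast
  define W where "W = {v. Inl v \<in> set ws}"
  show ?thesis
  proof
    show "finite W" unfolding W_def by (rule finite_vimageI[of "set ws" Inl, unfolded vimage_def]) auto
    show "W \<subseteq> V" using P(1) by (auto simp: W_def)
    have "set ws \<subseteq> W <+> A"
    proof
      fix w assume "w \<in> set ws"
      then show "w \<in> W <+> A" using P(1) by (cases w) (auto simp: W_def)
    qed
    then show "dfn srt W A (\<lambda>\<rho>. sat N (map (case_sum \<rho> id) ws) \<phi>)"
      using P(2) by (rule dfnI) simp
    show "P \<rho> \<longleftrightarrow> sat N (map (case_sum \<rho> id) ws) \<phi>" if "\<rho> \<in> Env srt V" for \<rho>
      using P(3) that by blast
    fix \<rho> \<rho>' :: "'b \<Rightarrow> 'a"
    assume "\<forall>v\<in>W. \<rho> v = \<rho>' v"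
    then have "map (case_sum \<rho> id) ws = map (case_sum \<rho>' id) ws"
      by (auto simp: W_def split: sum.split)
    then show "sat N (map (case_sum \<rho> id) ws) \<phi> \<longleftrightarrow> sat N (map (case_sum \<rho>' id) ws) \<phi>"
      by (simp only:)
  qed
qed

text \<open>A variable may be replaced by a variable or a parameter of the same sort. Only the
  labels change; the formula stays the same.\<close>

lemma dfn_subst:
  assumes "dfn srt V A P" and "A \<subseteq> A'" and "A' \<subseteq> elems L N"
    and "\<And>v. v \<in> V \<Longrightarrow> \<sigma> v \<in> W <+> A' \<and> case_sum srt' sort_of (\<sigma> v) = srt v"
  shows "dfn srt' W A' (\<lambda>\<rho>. P (\<lambda>v. case_sum \<rho> id (\<sigma> v)))"
proof -
  obtain ws \<phi> where P: "set ws \<subseteq> V <+> A" "\<phi> \<in> Fm L (map (case_sum srt sort_of) ws)"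
    "\<forall>\<rho>\<in>Env srt V. P \<rho> \<longleftrightarrow> sat N (map (case_sum \<rho> id) ws) \<phi>"
    using assms(1) unfolding dfn_def by blast
  let ?\<sigma> = "case_sum \<sigma> Inr"
  have \<sigma>: "?\<sigma> w \<in> W <+> A' \<and> case_sum srt' sort_of (?\<sigma> w) = case_sum srt sort_of w"
    if "w \<in> set ws" for w
  proof (cases w)
    case (Inl v)
    then have "v \<in> V" using P(1) that by auto
    then show ?thesis using assms(4)[of v] Inl by simp
  next
    case (Inr a)
    then have "a \<in> A" using P(1) that by auto
    then show ?thesis using assms(2) Inr by auto
  qed
  show ?thesis
  proof (rule dfnI)
    show "set (map ?\<sigma> ws) \<subseteq> W <+> A'" using \<sigma> by auto
    have "map (case_sum srt' sort_of) (map ?\<sigma> ws) = map (case_sum srt sort_of) ws" using \<sigma> by simp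
    then show "\<phi> \<in> Fm L (map (case_sum srt' sort_of) (map ?\<sigma> ws))" using P(2) by (simp only:)
    fix \<rho> assume \<rho>: "\<rho> \<in> Env srt' W"
    have "case_sum \<rho> id (\<sigma> v) \<in> carrier N (srt v)" if "v \<in> V" for v
    proof (cases "\<sigma> v")
      case (Inl w)
      then show ?thesis using assms(4)[OF that] \<rho> by (auto simp: Env_def)
    next
      case (Inr a)
      then show ?thesis using assms(4)[OF that] assms(3) sort_of(2)[of a] by auto
    qed
    then have "(\<lambda>v. case_sum \<rho> id (\<sigma> v)) \<in> Env srt V" by (simp add: Env_def)
    moreover have "map (case_sum (\<lambda>v. case_sum \<rho> id (\<sigma> v)) id) ws =
        map (case_sum \<rho> id) (map ?\<sigma> ws)" by (auto split: sum.split)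
    ultimately show "P (\<lambda>v. case_sum \<rho> id (\<sigma> v)) \<longleftrightarrow> sat N (map (case_sum \<rho> id) (map ?\<sigma> ws)) \<phi>"
      using P(3) by (simp only:)
  qed
qed

text \<open>The label \<open>Inl v\<close> may occur several times in \<open>ws\<close> or not at
  all. Renaming first gives it exactly one position, index 0, which \<open>Exists\<close> can
  bind.\<close>

lemma dfn_ex:
  assumes "dfn srt V A P" and "srt v \<in> Sorts L"
  shows "dfn srt (V - {v}) A (\<lambda>\<rho>. \<exists>a\<in>carrier N (srt v). P (\<rho>(v := a)))"
proof -
  let ?\<tau> = "case_sum srt sort_of"
  obtain ws \<phi> where P: "set ws \<subseteq> V <+> A" "\<phi> \<in> Fm L (map ?\<tau> ws)"
    "\<forall>\<rho>\<in>Env srt V. P \<rho> \<longleftrightarrow> sat N (map (case_sum \<rho> id) ws) \<phi>"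
    using assms(1) unfolding dfn_def by blast
  define us where "us = filter (\<lambda>w. w \<noteq> Inl v) ws"
  have S: "set ws \<subseteq> set (Inl v # us)" "?\<tau> ` set (Inl v # us) \<subseteq> Sorts L"
    using P(2) assms(2) by (auto simp: us_def Fm_def)
  obtain \<phi>' where \<phi>': "\<phi>' \<in> Fm L (map ?\<tau> (Inl v # us))"
    "\<And>\<eta>. sat N (map \<eta> (Inl v # us)) \<phi>' \<longleftrightarrow> sat N (map \<eta> ws) \<phi>"
    by (rule rename_variables[where M = N, OF P(2) S]) (rule that)
  show ?thesis
  proof (rule dfnI)
    show "set us \<subseteq> (V - {v}) <+> A" using P(1) by (auto simp: us_def)
    show "Exists (srt v) \<phi>' \<in> Fm L (map ?\<tau> us)" using \<phi>'(1) by (auto simp: Fm_def)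
    fix \<rho> assume \<rho>: "\<rho> \<in> Env srt (V - {v})"
    have "sat N (a # map (case_sum \<rho> id) us) \<phi>' \<longleftrightarrow> P (\<rho>(v := a))"
      if "a \<in> carrier N (srt v)" for a
    proof -
      have "a # map (case_sum \<rho> id) us = map (case_sum (\<rho>(v := a)) id) (Inl v # us)"
        by (auto simp: us_def split: sum.split)
      moreover have "\<rho>(v := a) \<in> Env srt V" using that \<rho> by (auto simp: Env_def)
      ultimately show ?thesis using P(3) by (simp only: \<phi>'(2))
    qed
    then show "(\<exists>a\<in>carrier N (srt v). P (\<rho>(v := a))) \<longleftrightarrow>
        sat N (map (case_sum \<rho> id) us) (Exists (srt v) \<phi>')" by auto
  qed
qed

lemma dfn_ex_finite:
  assumes "finite F" and "dfn srt V A P" and "srt ` F \<subseteq> Sorts L"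
  shows "dfn srt (V - F) A (\<lambda>\<rho>. \<exists>\<rho>'\<in>Env srt F. (\<forall>v. v \<notin> F \<longrightarrow> \<rho>' v = \<rho> v) \<and> P \<rho>')"
  using assms(1,3)
proof (induction F)
  case empty
  have "\<rho>' = \<rho>" if "\<forall>v. \<rho>' v = \<rho> v" for \<rho>' \<rho> :: "'b \<Rightarrow> 'a" using that by (rule_tac ext) simp
  then show ?case using dfn_cong[OF assms(2)] by (auto simp: Env_def intro: dfn_cong[OF assms(2)])
next
  case (insert v F)
  let ?Q = "\<lambda>\<rho>. \<exists>\<rho>'\<in>Env srt F. (\<forall>v. v \<notin> F \<longrightarrow> \<rho>' v = \<rho> v) \<and> P \<rho>'"
  have "dfn srt (V - F - {v}) A (\<lambda>\<rho>. \<exists>a\<in>carrier N (srt v). ?Q (\<rho>(v := a)))"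
    using insert by (intro dfn_ex) auto
  moreover have "V - F - {v} = V - insert v F" by auto
  moreover have "(\<exists>a\<in>carrier N (srt v). ?Q (\<rho>(v := a))) \<longleftrightarrow>
      (\<exists>\<rho>'\<in>Env srt (insert v F). (\<forall>u. u \<notin> insert v F \<longrightarrow> \<rho>' u = \<rho> u) \<and> P \<rho>')" for \<rho>
  proof
    assume "\<exists>a\<in>carrier N (srt v). ?Q (\<rho>(v := a))"
    then obtain a \<rho>' where a: "a \<in> carrier N (srt v)" "\<rho>' \<in> Env srt F"
      "\<forall>u. u \<notin> F \<longrightarrow> \<rho>' u = (\<rho>(v := a)) u" "P \<rho>'" by blast
    then show "\<exists>\<rho>'\<in>Env srt (insert v F). (\<forall>u. u \<notin> insert v F \<longrightarrow> \<rho>' u = \<rho> u) \<and> P \<rho>'"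
      using insert(2) by (intro bexI[of _ \<rho>']) (auto simp: Env_def)
  next
    assume "\<exists>\<rho>'\<in>Env srt (insert v F). (\<forall>u. u \<notin> insert v F \<longrightarrow> \<rho>' u = \<rho> u) \<and> P \<rho>'"
    then obtain \<rho>' where "\<rho>' \<in> Env srt (insert v F)" "\<forall>u. u \<notin> insert v F \<longrightarrow> \<rho>' u = \<rho> u" "P \<rho>'"
      by blast
    then show "\<exists>a\<in>carrier N (srt v). ?Q (\<rho>(v := a))"
      by (intro bexI[of _ "\<rho>' v"] bexI[of _ \<rho>']) (auto simp: Env_def)
  qed
  ultimately show ?case by simp
qed

lemma dfn_formula:
  assumes "\<phi> \<in> Fm L (map (case_sum srt sort_of) ws)" and "set ws \<subseteq> V <+> A"
  shows "dfn srt V A (\<lambda>\<rho>. sat N (map (case_sum \<rho> id) ws) \<phi>)"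
  using assms(2,1) by (rule dfnI) simp

lemma dfn_eq:
  assumes "u \<in> V" and "v \<in> V" and "srt u = srt v" and "srt v \<in> Sorts L"
  shows "dfn srt V A (\<lambda>\<rho>. \<rho> u = \<rho> v)"
proof (rule dfnI)
  show "Eq (Var 0) (Var 1) \<in> Fm L (map (case_sum srt sort_of) [Inl u, Inl v])"
    using assms has_sort.intros(1)[of 0 "[srt v, srt v]" L] has_sort.intros(1)[of 1 "[srt v, srt v]" L]
    by (auto simp: Fm_def)
qed (use assms in auto)

lemma dfn_eq_param:
  assumes "u \<in> V" and "a \<in> A" and "a \<in> elems L N" and "srt u = sort_of a"
  shows "dfn srt V A (\<lambda>\<rho>. \<rho> u = a)"
proof (rule dfnI)
  show "Eq (Var 0) (Var 1) \<in> Fm L (map (case_sum srt sort_of) [Inl u, Inr a])"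
    using assms sort_of(1) has_sort.intros(1)[of 0 "[sort_of a, sort_of a]" L]
      has_sort.intros(1)[of 1 "[sort_of a, sort_of a]" L]
    by (auto simp: Fm_def)
qed (use assms in auto)

text \<open>The way back to the official pairs: the variables \<open>vs\<close> are moved to the
  front and the finitely many parameters behind them.\<close>

lemma dfn_imp_Fm_over:
  assumes "dfn srt (set vs) A P" and "srt ` set vs \<subseteq> Sorts L" and "A \<subseteq> elems L N"
  obtains \<phi>c where "\<phi>c \<in> Fm_over L N (map srt vs) A"
    and "\<And>\<rho>. \<rho> \<in> Env srt (set vs) \<Longrightarrow> map \<rho> vs \<in> realisations N (map srt vs) {\<phi>c} \<longleftrightarrow> P \<rho>"
proof -
  let ?\<tau> = "case_sum srt sort_of"
  obtain ws \<phi> where P: "set ws \<subseteq> set vs <+> A" "\<phi> \<in> Fm L (map ?\<tau> ws)"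
    "\<forall>\<rho>\<in>Env srt (set vs). P \<rho> \<longleftrightarrow> sat N (map (case_sum \<rho> id) ws) \<phi>"
    using assms(1) unfolding dfn_def by blast
  obtain c where c: "set c = {a. Inr a \<in> set ws}"
    using finite_list[OF finite_vimageI[of "set ws" Inr]] by (auto simp: vimage_def)
  let ?us = "map Inl vs @ map Inr c"
  have sub: "set ws \<subseteq> set ?us"
  proof
    fix w assume "w \<in> set ws"
    then show "w \<in> set ?us" using P(1) c by (cases w) auto
  qed
  have cA: "set c \<subseteq> A" using c P(1) by auto
  have S: "?\<tau> ` set ?us \<subseteq> Sorts L"
    using assms(2,3) cA sort_of(1) by auto
  obtain \<psi> where \<psi>: "\<psi> \<in> Fm L (map ?\<tau> ?us)"
    "\<And>\<eta>. sat N (map \<eta> ?us) \<psi> \<longleftrightarrow> sat N (map \<eta> ws) \<phi>"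
    by (rule rename_variables[where M = N, OF P(2) sub S]) (rule that)
  show ?thesis
  proof
    show "(\<psi>, c) \<in> Fm_over L N (map srt vs) A"
      using \<psi>(1) cA assms(3) tuples_sort_of[of c] by (auto simp: Fm_over_def comp_def)
    fix \<rho> assume \<rho>: "\<rho> \<in> Env srt (set vs)"
    have "sat N (map \<rho> vs @ c) \<psi> \<longleftrightarrow> P \<rho>"
      using \<psi>(2)[of "case_sum \<rho> id"] P(3) \<rho> by (simp add: comp_def)
    then show "map \<rho> vs \<in> realisations N (map srt vs) {(\<psi>, c)} \<longleftrightarrow> P \<rho>"
      using \<rho> by (simp add: realisations_def tuples_map_iff Env_def)
  qed
qed

text \<open>The context \<open>\<Gamma>\<close> of the parameters must consist of their own sorts,
  so it agrees with the sorts of the labels \<open>Inr\<close>.\<close>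

lemma Fm_over_imp_dfn:
  assumes "\<phi>c \<in> Fm_over L N (map srt vs) A"
  shows "dfn srt (set vs) A (\<lambda>\<rho>. map \<rho> vs \<in> realisations N (map srt vs) {\<phi>c})"
proof -
  obtain \<phi> c \<Gamma> where \<phi>: "\<phi>c = (\<phi>, c)" "set c \<subseteq> A" "\<phi> \<in> Fm L (map srt vs @ \<Gamma>)" "c \<in> tuples N \<Gamma>"
    using assms by (auto simp: Fm_over_def)
  then have "\<Gamma> = map sort_of c" using tuples_sorts(1) by (auto simp: Fm_def)
  then have "dfn srt (set vs) A (\<lambda>\<rho>. sat N (map (case_sum \<rho> id) (map Inl vs @ map Inr c)) \<phi>)"
    using \<phi> by (intro dfn_formula) (auto simp: comp_def)
  then show ?thesis
    by (rule dfn_cong) (simp add: \<phi>(1) realisations_def Env_def tuples_map_iff comp_def)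
qed

section \<open>Saturation in many variables\<close>

lemma card_kappa: "Card_order \<kappa>" and infinite_kappa: "infinite (Field \<kappa>)"
proof -
  show "Card_order \<kappa>" using big by (simp add: big_cardinal_def)
  then have "\<kappa> =o |Field \<kappa>|" using card_of_Field_ordIso ordIso_symmetric by blast
  moreover have "natLeq \<le>o \<kappa>" using big ordLess_imp_ordLeq by (auto simp: big_cardinal_def)
  ultimately have "natLeq \<le>o |Field \<kappa>|" by (rule ordLeq_ordIso_trans[rotated])
  then show "infinite (Field \<kappa>)" using infinite_iff_natLeq_ordLeq by blast
qed

lemma small_Un: "small L \<kappa> N A \<Longrightarrow> small L \<kappa> N B \<Longrightarrow> small L \<kappa> N (A \<union> B)"
  using card_of_Un_ordLess_infinite_Field[OF infinite_kappa card_kappa] by (auto simp: small_def)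

lemma finite_ordLess_kappa: "finite A \<Longrightarrow> |A| <o \<kappa>"
  using big ordLess_transitive by (auto simp: finite_iff_ordLess_natLeq big_cardinal_def)

text \<open>
  Saturation is assumed for one variable only.  A partial assignment is good if every finite part
  of \<open>p\<close> is satisfied by some assignment extending it.  Definable predicates have finite support,
  so unions of chains of good assignments are good; saturation for one variable shows that a
  maximal one is total.
\<close>

lemma many_variable_saturation:
  fixes V :: "'v set"
  assumes V: "|V| <o \<kappa>" and srt: "srt ` V \<subseteq> Sorts L" and A: "small L \<kappa> N A"
    and p: "\<And>P. P \<in> p \<Longrightarrow> dfn srt V A P"
    and fin: "\<And>q. q \<subseteq> p \<Longrightarrow> finite q \<Longrightarrow> \<exists>\<rho>\<in>Env srt V. \<forall>P\<in>q. P \<rho>"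
  shows "\<exists>\<rho>\<in>Env srt V. \<forall>P\<in>p. P \<rho>"
proof -
  \<comment> \<open>Partial assignments are taken as graphs, so that Zorn's lemma for inclusion
    applies. Single-valuedness and correct sorts follow from the case \<open>q = {}\<close>.\<close>
  define good where "good = {G :: ('v \<times> 'a) set. fst ` G \<subseteq> V \<and>
    (\<forall>q\<subseteq>p. finite q \<longrightarrow> (\<exists>\<rho>\<in>Env srt V. (\<forall>(v, a)\<in>G. \<rho> v = a) \<and> (\<forall>P\<in>q. P \<rho>)))}"
  have goodD: "\<exists>\<rho>\<in>Env srt V. (\<forall>(v, a)\<in>G. \<rho> v = a) \<and> (\<forall>P\<in>q. P \<rho>)"
    if "G \<in> good" "q \<subseteq> p" "finite q" for G q
    using that unfolding good_def by blast
  have good_carrier: "v \<in> V \<and> a \<in> carrier N (srt v)" if G: "G \<in> good" "(v, a) \<in> G" for G v a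
  proof -
    have "v \<in> V" using G by (force simp: good_def)
    moreover obtain \<rho> where "\<rho> \<in> Env srt V" "\<forall>(v, a)\<in>G. \<rho> v = a"
      using goodD[OF G(1), of "{}"] by auto
    ultimately show ?thesis using G(2) by (auto simp: Env_def)
  qed
  have good_unique: "a = b" if G: "G \<in> good" "(v, a) \<in> G" "(v, b) \<in> G" for G v a b
  proof -
    obtain \<rho> where \<rho>: "\<forall>(v, a)\<in>G. \<rho> v = a"
      using goodD[OF G(1), of "{}"] by auto
    show ?thesis using bspec[OF \<rho> G(2)] bspec[OF \<rho> G(3)] by simp
  qed
  define supports where "supports P W \<longleftrightarrow> finite W \<and> W \<subseteq> V \<and>
      (\<forall>\<rho>\<in>Env srt V. \<forall>\<rho>'\<in>Env srt V. (\<forall>v\<in>W. \<rho> v = \<rho>' v) \<longrightarrow> (P \<rho> \<longleftrightarrow> P \<rho>'))" for P W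
  define W where "W P = (SOME W. supports P W)" for P
  have supports: "supports P (W P)" if P: "P \<in> p" for P
  proof -
    obtain W Q where "finite W" "W \<subseteq> V" "\<And>\<rho>. \<rho> \<in> Env srt V \<Longrightarrow> P \<rho> \<longleftrightarrow> Q \<rho>"
      "\<And>\<rho> \<rho>'. \<forall>v\<in>W. \<rho> v = \<rho>' v \<Longrightarrow> Q \<rho> \<longleftrightarrow> Q \<rho>'"
      by (rule dfn_finite_support[OF p[OF P]]) (rule that)
    then have "supports P W" unfolding supports_def by simp
    then show ?thesis unfolding W_def by (rule someI)
  qed
  then have W: "\<And>P. P \<in> p \<Longrightarrow> finite (W P)" "\<And>P. P \<in> p \<Longrightarrow> W P \<subseteq> V"
    by (simp_all add: supports_def)
  have W_cong: "P \<rho> \<longleftrightarrow> P \<rho>'" if "P \<in> p" "\<rho> \<in> Env srt V" "\<rho>' \<in> Env srt V" "\<forall>v\<in>W P. \<rho> v = \<rho>' v"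
    for P \<rho> \<rho>'
    using supports[OF that(1), unfolded supports_def] that(2-) by blast

  have chain: "\<Union>\<C> \<in> good" if C: "\<C> \<noteq> {}" "subset.chain good \<C>" for \<C>
  proof -
    have Cg: "\<C> \<subseteq> good" using C(2) by (simp add: subset.chain_def)
    have uniq: "a = b" if vab: "(v, a) \<in> \<Union>\<C>" "(v, b) \<in> \<Union>\<C>" for v a b
    proof -
      obtain G where "G \<in> \<C>" "{(v, a), (v, b)} \<subseteq> G"
        by (rule finite_subset_Union_chain[OF _ _ C, of "{(v, a), (v, b)}"]) (use vab in auto)
      then show ?thesis using good_unique[of G v a b] Cg by auto
    qed
    have "\<exists>\<rho>\<in>Env srt V. (\<forall>(v, a)\<in>\<Union>\<C>. \<rho> v = a) \<and> (\<forall>P\<in>q. P \<rho>)"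
      if q: "q \<subseteq> p" "finite q" for q
    proof -
      \<comment> \<open>Only variables in the finite set \<open>U\<close> matter for
        \<open>q\<close>. The part \<open>F\<close> of the union over \<open>U\<close> is finite, so
        it lies in one member \<open>G\<close>. An assignment for \<open>G\<close> can be
        overwritten by the whole union without a change on \<open>U\<close>.\<close>
      define U where "U = \<Union>(W ` q)"
      have U: "finite U" using q W(1) by (auto simp: U_def)
      define F where "F = {(v, a). (v, a) \<in> \<Union>\<C> \<and> v \<in> U}"
      have "finite F"
      proof (rule finite_imageD)
        show "finite (fst ` F)" by (rule finite_subset[OF _ U]) (auto simp: F_def)
        show "inj_on fst F" using uniq by (auto simp: F_def inj_on_def)
      qed
      moreover have "F \<subseteq> \<Union>\<C>" by (auto simp: F_def)
      ultimately obtain G where G: "G \<in> \<C>" "F \<subseteq> G"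
        by (rule finite_subset_Union_chain[OF _ _ C])
      have "G \<in> good" using G(1) Cg by blast
      from goodD[OF this q] obtain \<rho>
        where \<rho>: "\<rho> \<in> Env srt V" "\<forall>(v, a)\<in>G. \<rho> v = a" "\<forall>P\<in>q. P \<rho>"
        by blast
      define \<rho>' where "\<rho>' v = (if \<exists>a. (v, a) \<in> \<Union>\<C> then (THE a. (v, a) \<in> \<Union>\<C>) else \<rho> v)" for v
      have \<rho>'_eq: "\<rho>' v = a" if "(v, a) \<in> \<Union>\<C>" for v a
      proof -
        have "(THE a. (v, a) \<in> \<Union>\<C>) = a" using that uniq by (intro the_equality) auto
        then show ?thesis using that by (auto simp: \<rho>'_def)
      qed
      have env: "\<rho>' \<in> Env srt V"
        unfolding Env_def
      proof (intro CollectI ballI)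
        fix v assume v: "v \<in> V"
        show "\<rho>' v \<in> carrier N (srt v)"
        proof (cases "\<exists>a. (v, a) \<in> \<Union>\<C>")
          case True
          then obtain a G' where "(v, a) \<in> G'" "G' \<in> \<C>" by blast
          then show ?thesis using \<rho>'_eq[of v a] good_carrier[of G' v a] Cg by auto
        next
          case False
          then show ?thesis using \<rho>(1) v by (auto simp: \<rho>'_def Env_def)
        qed
      qed
      have "\<rho> v = \<rho>' v" if "v \<in> U" for v
      proof (cases "\<exists>a. (v, a) \<in> \<Union>\<C>")
        case True
        then obtain a where a: "(v, a) \<in> \<Union>\<C>" by blast
        then have "(v, a) \<in> G" using G(2) that by (auto simp: F_def)
        then show ?thesis using \<rho>'_eq[OF a] \<rho>(2) by auto
      next
        case False
        then show ?thesis by (auto simp: \<rho>'_def)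
      qed
      then have "P \<rho>'" if "P \<in> q" for P
        using W_cong[of P \<rho> \<rho>'] that q(1) \<rho>(1,3) env by (auto simp: U_def)
      then show ?thesis using env \<rho>'_eq by (intro bexI[of _ \<rho>']) auto
    qed
    moreover have "fst ` \<Union>\<C> \<subseteq> V" using Cg by (auto simp: good_def)
    ultimately show ?thesis unfolding good_def by blast
  qed
  have "{} \<in> good" using fin by (auto simp: good_def)
  then obtain M where M: "M \<in> good" and max: "\<And>G. G \<in> good \<Longrightarrow> M \<subseteq> G \<Longrightarrow> G = M"
    using subset_Zorn_nonempty[of good] chain by blast

  define S where "S = fst ` M"
  define h where "h v = (THE a. (v, a) \<in> M)" for v
  have h: "(v, h v) \<in> M" if "v \<in> S" for v
  proof -
    obtain a where a: "(v, a) \<in> M" using \<open>v \<in> S\<close> by (auto simp: S_def)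
    then have "h v = a" using good_unique[OF M] unfolding h_def by (intro the_equality) auto
    then show ?thesis using a by simp
  qed
  have h_eq: "h v = a" if "(v, a) \<in> M" for v a
  proof -
    have "v \<in> S" using that by (force simp: S_def)
    then show ?thesis using good_unique[OF M h that] by blast
  qed
  have SV: "S \<subseteq> V" using M by (auto simp: S_def good_def)
  have h_carrier: "h v \<in> carrier N (srt v)" if "v \<in> S" for v
    using good_carrier[OF M h[OF that]] by simp
  define A' where "A' = A \<union> h ` S"
  have "h ` S \<subseteq> elems L N"
    using h_carrier SV srt in_elems by blast
  moreover have "|h ` S| <o \<kappa>"
    using ordLeq_ordLess_trans[OF ordLeq_transitive[OF card_of_image card_of_mono1[OF SV]] V] .
  ultimately have A': "small L \<kappa> N A'"
    unfolding A'_def using A by (intro small_Un) (auto simp: small_def)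
  then have A'_elems: "A' \<subseteq> elems L N" by (simp add: small_def)

  have "S = V"
  proof (rule ccontr)
    assume "S \<noteq> V"
    then obtain v where v: "v \<in> V" "v \<notin> S" using SV by blast
    have sv: "srt v \<in> Sorts L" using v(1) srt by blast
    \<comment> \<open>\<open>M\<close> extended by \<open>(v, e)\<close> is good exactly when
      \<open>e\<close> lies in \<open>vals q\<close> for all finite \<open>q \<subseteq> p\<close>.
      So these sets have to be definable in one variable over a small set.\<close>
    define vals where "vals q = {\<rho> v | \<rho>. \<rho> \<in> Env srt V \<and> (\<forall>(u, a)\<in>M. \<rho> u = a) \<and> (\<forall>P\<in>q. P \<rho>)}" for q
    have definable: "\<exists>\<phi>c\<in>Fm_over L N [srt v] A'. realisations N [srt v] {\<phi>c} = (\<lambda>e. [e]) ` vals q"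
      if q: "q \<subseteq> p" "finite q" for q
    proof -
      have "dfn srt V A (\<lambda>\<rho>. \<forall>P\<in>q. P \<rho>)"
        using q p by (intro dfn_Ball[OF q(2), of _ _ _ "\<lambda>P. P"]) blast
      then obtain W' Q where Q: "finite W'" "W' \<subseteq> V" "dfn srt W' A Q"
        "\<And>\<rho>. \<rho> \<in> Env srt V \<Longrightarrow> (\<forall>P\<in>q. P \<rho>) \<longleftrightarrow> Q \<rho>"
        "\<And>\<rho> \<rho>'. \<forall>v\<in>W'. \<rho> v = \<rho>' v \<Longrightarrow> Q \<rho> \<longleftrightarrow> Q \<rho>'"
        by (rule dfn_finite_support) blast
      \<comment> \<open>Variables already assigned by \<open>M\<close> become parameters in
        \<open>A'\<close>. The rest of the finite support other than \<open>v\<close> is the set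
        \<open>F\<close>, which is quantified away.\<close>
      define \<sigma> where "\<sigma> u = (if u \<in> S then Inr (h u) else Inl u)" for u
      define Q1 where "Q1 \<rho> = Q (\<lambda>u. case_sum \<rho> id (\<sigma> u))" for \<rho> :: "'v \<Rightarrow> 'a"
      have "sort_of (h u) = srt u" if "u \<in> S" for u
        using sort_of_eq[OF _ h_carrier[OF that]] srt SV that by blast
      then have "dfn srt (W' - S) A' Q1"
        unfolding Q1_def
        by (intro dfn_subst[OF Q(3) _ A'_elems]) (auto simp: A'_def \<sigma>_def)
      define F where "F = W' - S - {v}"
      let ?Q2 = "\<lambda>\<rho>. \<exists>\<rho>'\<in>Env srt F. (\<forall>u. u \<notin> F \<longrightarrow> \<rho>' u = \<rho> u) \<and> Q1 \<rho>'"
      have "dfn srt (W' - S - F) A' ?Q2"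
        using Q(1,2) srt by (intro dfn_ex_finite \<open>dfn srt (W' - S) A' Q1\<close>) (auto simp: F_def)
      then have "dfn srt (set [v]) A' ?Q2"
        by (rule dfn_mono) (auto simp: F_def)
      then obtain \<phi>c where \<phi>c: "\<phi>c \<in> Fm_over L N (map srt [v]) A'"
        "\<And>\<rho>. \<rho> \<in> Env srt (set [v]) \<Longrightarrow>
          map \<rho> [v] \<in> realisations N (map srt [v]) {\<phi>c} \<longleftrightarrow> ?Q2 \<rho>"
        by (rule dfn_imp_Fm_over) (use sv A'_elems in auto)
      have "x \<in> (\<lambda>e. [e]) ` vals q" if x: "x \<in> realisations N [srt v] {\<phi>c}" for x
      proof -
        have "x \<in> tuples N [srt v]" using x by (simp add: realisations_def)
        then obtain e where e: "x = [e]" "e \<in> carrier N (srt v)"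
          by (auto simp: tuples_def list_all2_Cons2)
        then have "?Q2 (\<lambda>_. e)" using \<phi>c(2)[of "\<lambda>_. e"] x by (simp add: Env_def)
        then obtain \<rho>' where \<rho>': "\<rho>' \<in> Env srt F" "\<forall>u. u \<notin> F \<longrightarrow> \<rho>' u = e" "Q1 \<rho>'" by blast
        \<comment> \<open>Variables outside \<open>S\<close>, \<open>F\<close> and \<open>v\<close>
          may take any value of the right sort: the support of \<open>Q\<close> does not contain
          them.\<close>
        have "\<forall>u\<in>V. \<exists>a. a \<in> carrier N (srt u)" using carrier_nonempty srt by blast
        then obtain d where d: "\<And>u. u \<in> V \<Longrightarrow> d u \<in> carrier N (srt u)" by metis
        define \<rho> where "\<rho> u = (if u \<in> S then h u else if u \<in> insert v F then \<rho>' u else d u)" for u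
        have \<rho>v: "\<rho> v = e" using v(2) \<rho>'(2) by (auto simp: \<rho>_def F_def)
        have env: "\<rho> \<in> Env srt V"
          using \<rho>'(1,2) d h_carrier e(2) by (auto simp: Env_def \<rho>_def F_def)
        have "\<forall>u\<in>W'. \<rho> u = case_sum \<rho>' id (\<sigma> u)"
          by (auto simp: \<rho>_def \<sigma>_def F_def)
        then have "Q \<rho> \<longleftrightarrow> Q1 \<rho>'" unfolding Q1_def by (rule Q(5))
        then have "Q \<rho>" using \<rho>'(3) by simp
        then have "\<forall>P\<in>q. P \<rho>" using Q(4)[OF env] by blast
        moreover have "\<forall>(u, a)\<in>M. \<rho> u = a" using h_eq by (force simp: \<rho>_def S_def)
        ultimately have "e \<in> vals q" using env \<rho>v unfolding vals_def by blast
        then show ?thesis using e(1) by blast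
      qed
      moreover have "[e] \<in> realisations N [srt v] {\<phi>c}" if e: "e \<in> vals q" for e
      proof -
        obtain \<rho> where \<rho>: "e = \<rho> v" "\<rho> \<in> Env srt V" "\<forall>(u, a)\<in>M. \<rho> u = a" "\<forall>P\<in>q. P \<rho>"
          using e unfolding vals_def by blast
        have "\<rho> u = h u" if "u \<in> S" for u using bspec[OF \<rho>(3) h[OF that]] by simp
        then have "(\<lambda>u. case_sum \<rho> id (\<sigma> u)) = \<rho>" by (auto simp: \<sigma>_def)
        then have "Q1 \<rho>" using Q(4)[OF \<rho>(2)] \<rho>(4) by (simp add: Q1_def)
        moreover have "\<rho> \<in> Env srt F" using \<rho>(2) Q(2) by (auto simp: Env_def F_def)
        ultimately have "?Q2 \<rho>" by blast
        moreover have "\<rho> \<in> Env srt (set [v])" using \<rho>(2) v(1) by (simp add: Env_def)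
        ultimately show ?thesis using \<phi>c(2)[of \<rho>] \<rho>(1) by simp
      qed
      ultimately have "realisations N [srt v] {\<phi>c} = (\<lambda>e. [e]) ` vals q" by blast
      then show ?thesis using \<phi>c(1) by (intro bexI[of _ \<phi>c]) simp_all
    qed
    \<comment> \<open>This is the one-variable type to be realised. Finitely many of its members
      come from finitely many sets \<open>q\<close>, and goodness of \<open>M\<close> for their
      union gives a common solution.\<close>
    define r where "r = {\<phi>c \<in> Fm_over L N [srt v] A'.
      \<exists>q. q \<subseteq> p \<and> finite q \<and> realisations N [srt v] {\<phi>c} = (\<lambda>e. [e]) ` vals q}"
    have "realisations N [srt v] r0 \<noteq> {}" if r0: "r0 \<subseteq> r" "finite r0" for r0
    proof -
      have "\<forall>\<phi>c\<in>r0. \<exists>q. q \<subseteq> p \<and> finite q \<and> realisations N [srt v] {\<phi>c} = (\<lambda>e. [e]) ` vals q"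
        using r0 unfolding r_def by blast
      then obtain f where f: "\<And>\<phi>c. \<phi>c \<in> r0 \<Longrightarrow> f \<phi>c \<subseteq> p \<and> finite (f \<phi>c) \<and>
          realisations N [srt v] {\<phi>c} = (\<lambda>e. [e]) ` vals (f \<phi>c)" by metis
      have "\<Union>(f ` r0) \<subseteq> p" "finite (\<Union>(f ` r0))" using f r0(2) by blast+
      from goodD[OF M this] obtain \<rho>
        where \<rho>: "\<rho> \<in> Env srt V" "\<forall>(v, a)\<in>M. \<rho> v = a" "\<forall>P\<in>\<Union>(f ` r0). P \<rho>"
        by blast
      have "[\<rho> v] \<in> realisations N [srt v] {\<phi>c}" if "\<phi>c \<in> r0" for \<phi>c
      proof -
        have "\<rho> v \<in> vals (f \<phi>c)" using \<rho> that unfolding vals_def by blast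
        then show ?thesis using f[OF that] by blast
      qed
      moreover have "[\<rho> v] \<in> tuples N [srt v]" using \<rho>(1) v(1) by (auto simp: Env_def tuples_def)
      ultimately have "[\<rho> v] \<in> realisations N [srt v] r0"
        unfolding realisations_def by fastforce
      then show ?thesis by blast
    qed
    moreover have "r \<subseteq> Fm_over L N [srt v] A'" by (auto simp: r_def)
    ultimately have "realisations N [srt v] r \<noteq> {}"
      using saturated A' sv unfolding saturated_def small_def by blast
    then obtain x where x: "x \<in> realisations N [srt v] r" by blast
    then have "x \<in> tuples N [srt v]" by (simp add: realisations_def)
    then obtain e where e: "x = [e]" by (auto simp: tuples_def list_all2_Cons2)
    have vals: "e \<in> vals q" if q: "q \<subseteq> p" "finite q" for q
    proof -
      obtain \<phi>c where \<phi>c: "\<phi>c \<in> Fm_over L N [srt v] A'"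
        "realisations N [srt v] {\<phi>c} = (\<lambda>e. [e]) ` vals q"
        using definable[OF q] by blast
      then have "\<phi>c \<in> r" using q unfolding r_def by blast
      then have "[e] \<in> realisations N [srt v] {\<phi>c}" using x e unfolding realisations_def by blast
      then show ?thesis using \<phi>c(2) by auto
    qed
    have "\<exists>\<rho>\<in>Env srt V. (\<forall>(u, a)\<in>insert (v, e) M. \<rho> u = a) \<and> (\<forall>P\<in>q. P \<rho>)"
      if q: "q \<subseteq> p" "finite q" for q
    proof -
      obtain \<rho> where "e = \<rho> v" "\<rho> \<in> Env srt V" "\<forall>(u, a)\<in>M. \<rho> u = a" "\<forall>P\<in>q. P \<rho>"
        using vals[OF q] unfolding vals_def by blast
      then show ?thesis by (intro bexI[of _ \<rho>]) simp_all
    qed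
    then have "insert (v, e) M \<in> good" using M v(1) by (auto simp: good_def)
    then have "(v, e) \<in> M" using max by blast
    then show False using v(2) by (force simp: S_def)
  qed
  have env: "h \<in> Env srt V" using h_carrier \<open>S = V\<close> by (simp add: Env_def)
  moreover have "P h" if P: "P \<in> p" for P
  proof -
    obtain \<rho> where \<rho>: "\<rho> \<in> Env srt V" "\<forall>(v, a)\<in>M. \<rho> v = a" "P \<rho>"
      using goodD[OF M, of "{P}"] P by auto
    have "\<rho> v = h v" if "v \<in> V" for v using bspec[OF \<rho>(2) h[of v]] that \<open>S = V\<close> by simp
    then show ?thesis using W_cong[OF P \<rho>(1) env] W(2)[OF P] \<rho>(3) by blast
  qed
  ultimately show ?thesis by blast
qed

section \<open>Algebraic closure and types\<close>

text \<open>This is the quantifier "at least \<open>n\<close>". The \<open>n\<close> solutions are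
  named by fresh variables \<open>Inr i\<close>, declared pairwise distinct, and quantified.\<close>

lemma dfn_card:
  fixes srt :: "'v \<Rightarrow> 's"
  assumes P: "dfn srt V A P" and v: "srt v \<in> Sorts L" and A: "A \<subseteq> elems L N"
  shows "dfn srt (V - {v}) A
    (\<lambda>\<rho>. \<exists>K \<subseteq> {y \<in> carrier N (srt v). P (\<rho>(v := y))}. finite K \<and> card K = n)"
proof -
  define srt2 :: "'v + nat \<Rightarrow> 's" where "srt2 = case_sum srt (\<lambda>_. srt v)"
  define F :: "('v + nat) set" where "F = Inr ` {..<n}"
  define V2 where "V2 = Inl ` (V - {v}) \<union> F"
  define Q where "Q \<eta> \<longleftrightarrow> (\<forall>i\<in>{..<n}. P (\<lambda>u. if u = v then \<eta> (Inr i) else \<eta> (Inl u))) \<and>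
    (\<forall>i\<in>{..<n}. \<forall>j\<in>{..<n} - {i}. \<not> \<eta> (Inr i) = \<eta> (Inr j))" for \<eta> :: "'v + nat \<Rightarrow> 'a"
  have "dfn srt2 V2 A (\<lambda>\<eta>. P (\<lambda>u. if u = v then \<eta> (Inr i) else \<eta> (Inl u)))" if "i \<in> {..<n}" for i
  proof -
    have "dfn srt2 V2 A (\<lambda>\<eta>. P (\<lambda>u. case_sum \<eta> id (if u = v then Inl (Inr i) else Inl (Inl u))))"
      using that by (intro dfn_subst[OF P order_refl A]) (auto simp: V2_def F_def srt2_def)
    then show ?thesis by (rule dfn_cong) (simp add: if_distrib cong: if_cong)
  qed
  moreover have "dfn srt2 V2 A (\<lambda>\<eta>. \<not> \<eta> (Inr i) = \<eta> (Inr j))" if "i \<in> {..<n}" "j \<in> {..<n} - {i}" for i j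
    using that v by (intro dfn_neg dfn_eq) (auto simp: V2_def F_def srt2_def)
  ultimately have "dfn srt2 V2 A Q"
    unfolding Q_def by (intro dfn_conj dfn_Ball) auto
  then have "dfn srt2 (V2 - F) A (\<lambda>\<eta>. \<exists>\<eta>'\<in>Env srt2 F. (\<forall>w. w \<notin> F \<longrightarrow> \<eta>' w = \<eta> w) \<and> Q \<eta>')"
    using v by (intro dfn_ex_finite) (auto simp: F_def srt2_def)
  \<comment> \<open>Return to the original variable type. No \<open>Inr i\<close> is free any more,
    so its image \<open>Inl v\<close> is only a default.\<close>
  then have "dfn srt (V - {v}) A (\<lambda>\<rho>. (\<lambda>\<eta>. \<exists>\<eta>'\<in>Env srt2 F. (\<forall>w. w \<notin> F \<longrightarrow> \<eta>' w = \<eta> w) \<and> Q \<eta>')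
      (\<lambda>w. case_sum \<rho> id (case_sum Inl (\<lambda>_. Inl v) w)))"
    using A by (rule dfn_subst[OF _ order_refl]) (auto simp: V2_def F_def srt2_def)
  then show ?thesis
  proof (rule dfn_cong)
    fix \<rho> :: "'v \<Rightarrow> 'a"
    let ?\<eta> = "\<lambda>w. case_sum \<rho> id (case_sum Inl (\<lambda>_. Inl v) w)"
    show "(\<exists>\<eta>'\<in>Env srt2 F. (\<forall>w. w \<notin> F \<longrightarrow> \<eta>' w = ?\<eta> w) \<and> Q \<eta>') \<longleftrightarrow>
      (\<exists>K \<subseteq> {y \<in> carrier N (srt v). P (\<rho>(v := y))}. finite K \<and> card K = n)"
    proof
      assume "\<exists>\<eta>'\<in>Env srt2 F. (\<forall>w. w \<notin> F \<longrightarrow> \<eta>' w = ?\<eta> w) \<and> Q \<eta>'"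
      then obtain \<eta>' where \<eta>': "\<eta>' \<in> Env srt2 F" "\<forall>w. w \<notin> F \<longrightarrow> \<eta>' w = ?\<eta> w" "Q \<eta>'" by blast
      have "(\<lambda>u. if u = v then \<eta>' (Inr i) else \<eta>' (Inl u)) = \<rho>(v := \<eta>' (Inr i))" for i
      proof -
        have "\<eta>' (Inl u) = \<rho> u" for u using \<eta>'(2)[rule_format, of "Inl u"] by (simp add: F_def image_iff)
        then show ?thesis by auto
      qed
      then have "P (\<rho>(v := \<eta>' (Inr i)))" if "i < n" for i
        using \<eta>'(3) that by (simp add: Q_def)
      moreover have "\<eta>' (Inr i) \<in> carrier N (srt v)" if "i < n" for i
        using \<eta>'(1) that by (auto simp: Env_def F_def srt2_def)
      moreover have "inj_on (\<lambda>i. \<eta>' (Inr i)) {..<n}"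
        using \<eta>'(3) by (auto simp: Q_def inj_on_def)
      then have "card ((\<lambda>i. \<eta>' (Inr i)) ` {..<n}) = n" by (simp add: card_image)
      ultimately show "\<exists>K \<subseteq> {y \<in> carrier N (srt v). P (\<rho>(v := y))}. finite K \<and> card K = n"
        by (intro exI[of _ "(\<lambda>i. \<eta>' (Inr i)) ` {..<n}"]) auto
    next
      assume "\<exists>K \<subseteq> {y \<in> carrier N (srt v). P (\<rho>(v := y))}. finite K \<and> card K = n"
      then obtain K where K: "K \<subseteq> {y \<in> carrier N (srt v). P (\<rho>(v := y))}" "finite K" "card K = n"
        by blast
      obtain f where f: "bij_betw f {0..<n} K" using ex_bij_betw_nat_finite[OF K(2)] K(3) by blast
      have fK: "f i \<in> K" if "i < n" for i using f that by (auto simp: bij_betw_def)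
      have f_inj: "i = j" if "i < n" "j < n" "f i = f j" for i j
        using f that by (auto simp: bij_betw_def dest: inj_onD)
      \<comment> \<open>The value \<open>\<rho> v\<close> at indices \<open>i \<ge> n\<close> is
        forced: there \<open>\<eta>'\<close> must agree with \<open>?\<eta>\<close>.\<close>
      define \<eta>' where "\<eta>' = case_sum \<rho> (\<lambda>i. if i < n then f i else \<rho> v)"
      have "(\<lambda>u. if u = v then \<eta>' (Inr i) else \<eta>' (Inl u)) = \<rho>(v := f i)" if "i < n" for i
        using that by (auto simp: \<eta>'_def)
      then have "Q \<eta>'" unfolding Q_def using K(1) fK f_inj by (auto simp: \<eta>'_def)
      moreover have "\<eta>' \<in> Env srt2 F" using fK K(1) by (auto simp: Env_def F_def srt2_def \<eta>'_def)
      moreover have "\<eta>' w = ?\<eta> w" if "w \<notin> F" for w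
        using that by (cases w) (auto simp: \<eta>'_def F_def)
      ultimately show "\<exists>\<eta>'\<in>Env srt2 F. (\<forall>w. w \<notin> F \<longrightarrow> \<eta>' w = ?\<eta> w) \<and> Q \<eta>'"
        by (intro bexI[of _ \<eta>']) auto
    qed
  qed
qed

section \<open>Types of finite tuples and their algebraicity\<close>

lemma realisations_single: "a \<in> realisations N X {(\<phi>, c)} \<longleftrightarrow> a \<in> tuples N X \<and> sat N (a @ c) \<phi>"
  by (simp add: realisations_def)

lemma realisations_tp: "t \<in> realisations N Y (tp L N Y d A) \<longleftrightarrow> t \<in> tuples N Y \<and>
    (\<forall>\<phi>c\<in>Fm_over L N Y A. d \<in> realisations N Y {\<phi>c} \<longrightarrow> t \<in> realisations N Y {\<phi>c})"
  by (auto simp: realisations_def tp_def)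

lemma mem_tp: "\<phi>c \<in> tp L N Y d A \<longleftrightarrow> \<phi>c \<in> Fm_over L N Y A \<and> d \<in> realisations N Y {\<phi>c}"
  by (simp add: tp_def)

lemma realisations_tp_antimono:
  assumes "A \<subseteq> A'"
  shows "realisations N Y (tp L N Y d A') \<subseteq> realisations N Y (tp L N Y d A)"
proof -
  have "tp L N Y d A \<subseteq> tp L N Y d A'" using assms by (auto simp: tp_def Fm_over_def)
  then show ?thesis by (auto simp: realisations_def)
qed

text \<open>Positions serve as variables, so \<open>t\<close> itself is the assignment
  \<open>(!) t\<close>, even if sorts or entries repeat.\<close>

lemma nth_tuple_Env: "t \<in> tuples N Y \<Longrightarrow> (!) t \<in> Env ((!) Y) (set [0..<length Y])"
  by (auto simp: tuples_def Env_def list_all2_conv_all_nth)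

lemma map_nth_tuple: "t \<in> tuples N Y \<Longrightarrow> map ((!) t) [0..<length Y] = t"
  using length_tuples map_nth by metis

text \<open>The formula equating variable \<open>i\<close> with the parameter \<open>d ! i\<close>
  belongs to the type. In a type over \<open>Cc\<close> this freezes the entries from
  \<open>c\<close>.\<close>

lemma realisations_tp_nth:
  assumes t: "t \<in> realisations N Y (tp L N Y d A)" and d: "d \<in> tuples N Y" and Y: "set Y \<subseteq> Sorts L"
    and A: "A \<subseteq> elems L N" and i: "i < length Y" "d ! i \<in> A"
  shows "t ! i = d ! i"
proof -
  have "Y ! i \<in> Sorts L" using Y i(1) nth_mem by blast
  moreover have "d ! i \<in> carrier N (Y ! i)" using d i(1) by (auto simp: tuples_def list_all2_conv_all_nth)
  ultimately have "Y ! i = sort_of (d ! i)" using sort_of_eq by simp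
  then have "dfn ((!) Y) (set [0..<length Y]) A (\<lambda>\<rho>. \<rho> i = d ! i)"
    using i A by (intro dfn_eq_param) auto
  then obtain \<phi>c where \<phi>c: "\<phi>c \<in> Fm_over L N (map ((!) Y) [0..<length Y]) A"
    "\<And>\<rho>. \<rho> \<in> Env ((!) Y) (set [0..<length Y]) \<Longrightarrow>
      map \<rho> [0..<length Y] \<in> realisations N (map ((!) Y) [0..<length Y]) {\<phi>c} \<longleftrightarrow> \<rho> i = d ! i"
    by (rule dfn_imp_Fm_over) (use Y A in auto)
  have eq: "map ((!) Y) [0..<length Y] = Y" by (rule map_nth)
  have tt: "t \<in> tuples N Y" using t by (simp add: realisations_def)
  have "d \<in> realisations N Y {\<phi>c}"
    using \<phi>c(2)[OF nth_tuple_Env[OF d]] by (simp only: map_nth_tuple[OF d] eq)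
  then have "t \<in> realisations N Y {\<phi>c}" using t \<phi>c(1) by (simp only: realisations_tp eq)
  then show ?thesis using \<phi>c(2)[OF nth_tuple_Env[OF tt]] by (simp only: map_nth_tuple[OF tt] eq)
qed

lemma acl_subset_elems: "acl L N A \<subseteq> elems L N"
  by (auto simp: acl_def realisations_def tuples_def elems_def)

lemma acl_mono: "A \<subseteq> B \<Longrightarrow> acl L N A \<subseteq> acl L N B"
  unfolding acl_def Fm_over_def by blast

lemma aclI:
  assumes P: "dfn srt {v} A P" and v: "srt v \<in> Sorts L" and A: "A \<subseteq> elems L N"
    and fin: "finite {a \<in> carrier N (srt v). P (\<lambda>_. a)}" and e: "e \<in> carrier N (srt v)" "P (\<lambda>_. e)"
  shows "e \<in> acl L N A"
proof -
  have "dfn srt (set [v]) A P" using P by simp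
  then obtain \<phi>c where \<phi>c: "\<phi>c \<in> Fm_over L N (map srt [v]) A"
    "\<And>\<rho>. \<rho> \<in> Env srt (set [v]) \<Longrightarrow> map \<rho> [v] \<in> realisations N (map srt [v]) {\<phi>c} \<longleftrightarrow> P \<rho>"
    by (rule dfn_imp_Fm_over) (use v A in auto)
  have real: "[a] \<in> realisations N [srt v] {\<phi>c} \<longleftrightarrow> P (\<lambda>_. a)" if "a \<in> carrier N (srt v)" for a
    using \<phi>c(2)[of "\<lambda>_. a"] that by (simp add: Env_def)
  have "realisations N [srt v] {\<phi>c} \<subseteq> (\<lambda>a. [a]) ` {a \<in> carrier N (srt v). P (\<lambda>_. a)}"
  proof
    fix x assume x: "x \<in> realisations N [srt v] {\<phi>c}"
    then have "x \<in> tuples N [srt v]" by (simp add: realisations_def)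
    then obtain a where "x = [a]" "a \<in> carrier N (srt v)"
      by (auto simp: tuples_def list_all2_Cons2)
    then show "x \<in> (\<lambda>a. [a]) ` {a \<in> carrier N (srt v). P (\<lambda>_. a)}" using real x by blast
  qed
  then have "finite (realisations N [srt v] {\<phi>c})" using fin finite_subset by blast
  moreover have "[e] \<in> realisations N [srt v] {\<phi>c}" using real e by blast
  ultimately show ?thesis using \<phi>c(1) v unfolding acl_def algebraic_def by auto
qed

lemma subset_acl:
  assumes "A \<subseteq> elems L N"
  shows "A \<subseteq> acl L N A"
proof
  fix a assume a: "a \<in> A"
  then have ae: "a \<in> elems L N" using assms by blast
  have "dfn (\<lambda>_. sort_of a) {()} A (\<lambda>\<rho>. \<rho> () = a)" using a ae by (intro dfn_eq_param) auto
  then show "a \<in> acl L N A" by (rule aclI) (use sort_of[OF ae] assms in auto)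
qed

text \<open>Each algebraic formula contributes finitely many elements, and the formulas with
  parameters in \<open>A\<close> number at most the disjoint sum \<open>U\<close> of the natural
  numbers, the sorts, the symbols and \<open>A\<close>. This is below \<open>\<kappa>\<close>, which
  is uncountable and exceeds the language.\<close>

lemma small_acl:
  assumes "small L \<kappa> N A"
  shows "small L \<kappa> N (acl L N A)"
proof -
  define U where "U = (UNIV :: nat set) <+> Sorts L <+> Funs L <+> Rels L <+> A"
  have U: "infinite U" unfolding U_def by (simp add: finite_Plus_iff)
  have "|UNIV :: nat set| <o \<kappa>"
    by (rule ordIso_ordLess_trans[OF card_of_nat]) (use big in \<open>simp add: big_cardinal_def\<close>)
  then have U\<kappa>: "|U| <o \<kappa>"
    using big assms unfolding U_def big_cardinal_def small_def
    by (intro card_of_Plus_ordLess_infinite_Field infinite_kappa) auto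
  have inj: "|Sorts L| \<le>o |U|" "|Funs L| \<le>o |U|" "|Rels L| \<le>o |U|" "|A| \<le>o |U|"
    unfolding U_def
       apply (rule card_of_ordLeqI[of "\<lambda>x. Inr (Inl x)"]; auto simp: inj_on_def)
      apply (rule card_of_ordLeqI[of "\<lambda>x. Inr (Inr (Inl x))"]; auto simp: inj_on_def)
     apply (rule card_of_ordLeqI[of "\<lambda>x. Inr (Inr (Inr (Inl x)))"]; auto simp: inj_on_def)
    apply (rule card_of_ordLeqI[of "\<lambda>x. Inr (Inr (Inr (Inr x)))"]; auto simp: inj_on_def)
    done
  define I where "I = Sorts L \<times> {\<phi>. \<exists>\<Gamma>. well_sorted L \<Gamma> \<phi>} \<times> lists A"
  define f where "f = (\<lambda>(s, \<phi>, c). if finite (realisations N [s] {(\<phi>, c)})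
    then hd ` realisations N [s] {(\<phi>, c)} else {})"
  have "|I| \<le>o |U|"
    unfolding I_def by (intro card_of_Times_ordLeq card_of_lists_ordLeq card_of_formulas U inj)
  moreover have "\<forall>i\<in>I. |f i| \<le>o |U|"
    by (auto simp: f_def intro!: card_of_finite_ordLeq[OF U])
  ultimately have "|\<Union>i\<in>I. f i| \<le>o |U|" by (rule card_of_UNION_ordLeq_infinite[OF U])
  moreover have "acl L N A \<subseteq> (\<Union>i\<in>I. f i)"
  proof
    fix e assume "e \<in> acl L N A"
    then obtain s \<phi> c where s: "s \<in> Sorts L" "(\<phi>, c) \<in> Fm_over L N [s] A"
      "finite (realisations N [s] {(\<phi>, c)})" "[e] \<in> realisations N [s] {(\<phi>, c)}"
      unfolding acl_def algebraic_def by auto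
    then have "(s, \<phi>, c) \<in> I" by (auto simp: I_def Fm_over_def Fm_def)
    moreover have "e \<in> f (s, \<phi>, c)" using s(3,4) by (force simp: f_def)
    ultimately show "e \<in> (\<Union>i\<in>I. f i)" by blast
  qed
  ultimately have "|acl L N A| \<le>o |U|" by (rule card_of_subset_ordLeq)
  then show ?thesis
    using acl_subset_elems ordLeq_ordLess_trans[OF _ U\<kappa>] by (simp add: small_def)
qed

text \<open>Moving the variables for \<open>c\<close> to the parameter side cannot create solutions:
  each solution \<open>y\<close> gives the solution \<open>y # c\<close> of the original formula.
  The context is a list, so the formula itself need not change.\<close>

lemma algebraic_tp_Cons_imp_acl:
  assumes alg: "algebraic_type N (s # W) (tp L N (s # W) (e # c) A)" and c: "set c \<subseteq> A"
  shows "e \<in> acl L N A"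
proof -
  obtain \<phi> p where \<phi>: "(\<phi>, p) \<in> Fm_over L N (s # W) A" "finite (realisations N (s # W) {(\<phi>, p)})"
    "e # c \<in> realisations N (s # W) {(\<phi>, p)}"
    using alg unfolding algebraic_type_def algebraic_def tp_def by auto
  then obtain \<Gamma> where \<Gamma>: "\<phi> \<in> Fm L ((s # W) @ \<Gamma>)" "p \<in> tuples N \<Gamma>" "set p \<subseteq> A"
    by (auto simp: Fm_over_def)
  have ec: "e \<in> carrier N s" "c \<in> tuples N W"
    using \<phi>(3) by (auto simp: realisations_def tuples_def)
  have "(\<phi>, c @ p) \<in> Fm_over L N [s] A"
    using \<Gamma> c ec(2) by (auto simp: Fm_over_def tuples_def intro!: exI[of _ "W @ \<Gamma>"] list_all2_appendI)
  moreover have "(\<lambda>x. hd x # c) ` realisations N [s] {(\<phi>, c @ p)} \<subseteq> realisations N (s # W) {(\<phi>, p)}"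
    using ec(2) by (auto simp: realisations_def tuples_def list_all2_Cons2)
  then have "finite ((\<lambda>x. hd x # c) ` realisations N [s] {(\<phi>, c @ p)})"
    using \<phi>(2) finite_subset by blast
  then have "finite (realisations N [s] {(\<phi>, c @ p)})"
    by (rule finite_imageD) (auto simp: inj_on_def realisations_def tuples_def list_all2_Cons2)
  moreover have "[e] \<in> realisations N [s] {(\<phi>, c @ p)}"
    using \<phi>(3) by (simp add: realisations_def tuples_def)
  moreover have "s \<in> Sorts L" using \<Gamma>(1) by (simp add: Fm_def)
  ultimately show ?thesis unfolding acl_def algebraic_def by blast
qed

text \<open>Each entry satisfies a projection of an algebraic formula, obtained by quantifying the
  other positions \<open>F\<close>; a projection of a finite set is finite.\<close>

lemma algebraic_tp_imp_acl:
  assumes alg: "algebraic_type N Y (tp L N Y d A)" and A: "A \<subseteq> elems L N"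
  shows "set d \<subseteq> acl L N A"
proof
  fix e assume "e \<in> set d"
  obtain \<phi>c where \<phi>c: "\<phi>c \<in> Fm_over L N Y A" "finite (realisations N Y {\<phi>c})"
    "d \<in> realisations N Y {\<phi>c}"
    using alg unfolding algebraic_type_def algebraic_def tp_def by auto
  then have Y: "set Y \<subseteq> Sorts L" and d: "d \<in> tuples N Y"
    by (auto simp: Fm_over_def Fm_def realisations_def)
  let ?n = "length Y"
  obtain i where i: "i < ?n" "e = d ! i"
    using \<open>e \<in> set d\<close> length_tuples[OF d] by (auto simp: in_set_conv_nth)
  define F where "F = {0..<?n} - {i}"
  have eq: "map ((!) Y) [0..<?n] = Y" by (rule map_nth)
  let ?P = "\<lambda>\<rho>. \<exists>\<rho>'\<in>Env ((!) Y) F. (\<forall>v. v \<notin> F \<longrightarrow> \<rho>' v = \<rho> v) \<and>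
    map \<rho>' [0..<?n] \<in> realisations N Y {\<phi>c}"
  have "dfn ((!) Y) (set [0..<?n]) A (\<lambda>\<rho>. map \<rho> [0..<?n] \<in> realisations N (map ((!) Y) [0..<?n]) {\<phi>c})"
    using \<phi>c(1) by (intro Fm_over_imp_dfn) (simp only: eq)
  then have "dfn ((!) Y) (set [0..<?n]) A (\<lambda>\<rho>. map \<rho> [0..<?n] \<in> realisations N Y {\<phi>c})"
    by (simp only: eq)
  moreover have F: "finite F" "(!) Y ` F \<subseteq> Sorts L"
    by (auto simp: F_def intro!: subsetD[OF Y])
  ultimately have "dfn ((!) Y) (set [0..<?n] - F) A ?P" by (intro dfn_ex_finite)
  moreover have "set [0..<?n] - F = {i}" using i(1) by (auto simp: F_def)
  ultimately have "dfn ((!) Y) {i} A ?P" by simp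
  then show "e \<in> acl L N A"
  proof (rule aclI)
    show "Y ! i \<in> Sorts L" using Y i(1) nth_mem by blast
    show "A \<subseteq> elems L N" by fact
    show "e \<in> carrier N (Y ! i)"
      using d i by (auto simp: tuples_def list_all2_conv_all_nth)
    have "{a \<in> carrier N (Y ! i). ?P (\<lambda>_. a)} \<subseteq> (\<lambda>t. t ! i) ` realisations N Y {\<phi>c}"
    proof
      fix a assume "a \<in> {a \<in> carrier N (Y ! i). ?P (\<lambda>_. a)}"
      then obtain \<rho>' where \<rho>': "\<forall>v. v \<notin> F \<longrightarrow> \<rho>' v = a" "map \<rho>' [0..<?n] \<in> realisations N Y {\<phi>c}"
        by blast
      have "a = map \<rho>' [0..<?n] ! i" using \<rho>'(1) i(1) by (simp add: F_def)
      then show "a \<in> (\<lambda>t. t ! i) ` realisations N Y {\<phi>c}" using \<rho>'(2) by blast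
    qed
    then show "finite {a \<in> carrier N (Y ! i). ?P (\<lambda>_. a)}"
      using \<phi>c(2) finite_surj by blast
    let ?\<rho> = "\<lambda>v. if v \<in> F then d ! v else e"
    have "map ?\<rho> [0..<?n] = map ((!) d) [0..<?n]" using i by (auto simp: F_def)
    then have "map ?\<rho> [0..<?n] \<in> realisations N Y {\<phi>c}"
      using \<phi>c(3) by (simp only: map_nth_tuple[OF d])
    moreover have "?\<rho> \<in> Env ((!) Y) F"
      using d by (auto simp: Env_def F_def tuples_def list_all2_conv_all_nth)
    ultimately show "?P (\<lambda>_. e)" by (intro bexI[of _ ?\<rho>]) auto
  qed
qed

text \<open>Conjoin one algebraic formula per entry: all solutions lie in a finite product.\<close>

lemma acl_imp_algebraic_tp:
  assumes acl: "set d \<subseteq> acl L N A" and d: "d \<in> tuples N Y" and Y: "set Y \<subseteq> Sorts L"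
    and A: "A \<subseteq> elems L N"
  shows "algebraic_type N Y (tp L N Y d A)"
proof -
  let ?n = "length Y"
  have eq: "map ((!) Y) [0..<?n] = Y" by (rule map_nth)
  have "\<exists>\<phi>c. \<phi>c \<in> Fm_over L N [Y ! i] A \<and> finite (realisations N [Y ! i] {\<phi>c}) \<and>
      [d ! i] \<in> realisations N [Y ! i] {\<phi>c}" if i: "i < ?n" for i
  proof -
    have "d ! i \<in> acl L N A" using acl i length_tuples[OF d] by (auto simp: subset_iff)
    then obtain s \<phi>c where s: "s \<in> Sorts L" "\<phi>c \<in> Fm_over L N [s] A"
      "finite (realisations N [s] {\<phi>c})" "[d ! i] \<in> realisations N [s] {\<phi>c}"
      unfolding acl_def algebraic_def by auto
    have "d ! i \<in> carrier N s" using s(4) by (auto simp: realisations_def tuples_def)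
    moreover have "d ! i \<in> carrier N (Y ! i)" using d i by (auto simp: tuples_def list_all2_conv_all_nth)
    moreover have "Y ! i \<in> Sorts L" using Y i nth_mem by blast
    ultimately have "s = Y ! i" using s(1) sort_of_eq by metis
    then show ?thesis using s by blast
  qed
  then obtain f where f: "\<And>i. i < ?n \<Longrightarrow> f i \<in> Fm_over L N [Y ! i] A \<and>
      finite (realisations N [Y ! i] {f i}) \<and> [d ! i] \<in> realisations N [Y ! i] {f i}"
    by metis
  have "dfn ((!) Y) (set [0..<?n]) A (\<lambda>\<rho>. [\<rho> i] \<in> realisations N [Y ! i] {f i})"
    if i: "i \<in> {0..<?n}" for i
  proof -
    have "dfn ((!) Y) (set [i]) A (\<lambda>\<rho>. map \<rho> [i] \<in> realisations N (map ((!) Y) [i]) {f i})"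
      using f i by (intro Fm_over_imp_dfn) auto
    from dfn_mono[OF this, of "set [0..<?n]" A] show ?thesis using i by simp
  qed
  then have "dfn ((!) Y) (set [0..<?n]) A (\<lambda>\<rho>. \<forall>i\<in>{0..<?n}. [\<rho> i] \<in> realisations N [Y ! i] {f i})"
    by (intro dfn_Ball) auto
  then obtain \<phi>c where \<phi>c: "\<phi>c \<in> Fm_over L N (map ((!) Y) [0..<?n]) A"
    "\<And>\<rho>. \<rho> \<in> Env ((!) Y) (set [0..<?n]) \<Longrightarrow>
      map \<rho> [0..<?n] \<in> realisations N (map ((!) Y) [0..<?n]) {\<phi>c} \<longleftrightarrow>
      (\<forall>i\<in>{0..<?n}. [\<rho> i] \<in> realisations N [Y ! i] {f i})"
    by (rule dfn_imp_Fm_over) (use Y A in auto)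
  have real: "t \<in> realisations N Y {\<phi>c} \<longleftrightarrow> (\<forall>i\<in>{0..<?n}. [t ! i] \<in> realisations N [Y ! i] {f i})"
    if t: "t \<in> tuples N Y" for t
    using \<phi>c(2)[OF nth_tuple_Env[OF t]] by (simp only: map_nth_tuple[OF t] eq)
  have "d \<in> realisations N Y {\<phi>c}" using real[OF d] f by simp
  moreover have "realisations N Y {\<phi>c} \<subseteq>
      {t. set t \<subseteq> (\<Union>i\<in>{0..<?n}. hd ` realisations N [Y ! i] {f i}) \<and> length t = ?n}"
  proof (intro subsetI CollectI conjI)
    fix t x assume t: "t \<in> realisations N Y {\<phi>c}"
    then have tt: "t \<in> tuples N Y" by (simp add: realisations_def)
    then show len: "length t = ?n" by (rule length_tuples)
    assume "x \<in> set t"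
    then obtain i where i: "i < ?n" "x = t ! i" using len by (auto simp: in_set_conv_nth)
    then have "[x] \<in> realisations N [Y ! i] {f i}" using real[OF tt] t by simp
    then show "x \<in> (\<Union>i\<in>{0..<?n}. hd ` realisations N [Y ! i] {f i})" using i(1) by force
  qed
  then have "finite (realisations N Y {\<phi>c})"
    by (rule finite_subset) (use f in \<open>auto intro!: finite_lists_length_eq\<close>)
  ultimately show ?thesis
    using \<phi>c(1)[unfolded eq] unfolding algebraic_type_def algebraic_def tp_def by blast
qed

text \<open>Given \<open>k\<close> realisations \<open>D\<close>, a finite part of the type amounts
  to one formula. It has infinitely many solutions, hence one outside the finite set
  \<open>D\<close>, so saturation yields a further realisation.\<close>

lemma nonalgebraic_tp_realisations:
  assumes nonalg: "\<not> algebraic_type N Y (tp L N Y d A)" and d: "d \<in> tuples N Y"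
    and Y: "set Y \<subseteq> Sorts L" and A: "small L \<kappa> N A"
  shows "\<exists>D \<subseteq> realisations N Y (tp L N Y d A). finite D \<and> card D = k"
proof (induction k)
  case 0
  show ?case by (intro exI[of _ "{}"]) simp
next
  case (Suc k)
  then obtain D where D: "D \<subseteq> realisations N Y (tp L N Y d A)" "finite D" "card D = k" by blast
  let ?n = "length Y" and ?V = "set [0..<length Y]" and ?srt = "(!) Y"
  have eq: "map ?srt [0..<?n] = Y" by (rule map_nth)
  have DY: "D \<subseteq> tuples N Y" using D(1) by (auto simp: realisations_def)
  define A' where "A' = A \<union> \<Union>(set ` D)"
  have "\<Union>(set ` D) \<subseteq> elems L N" using DY tuples_sorts(2)[OF _ Y] by blast
  then have "small L \<kappa> N (\<Union>(set ` D))"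
    using D(2) by (auto simp: small_def intro!: finite_ordLess_kappa)
  then have A': "small L \<kappa> N A'" unfolding A'_def by (rule small_Un[OF A])
  have Ae: "A \<subseteq> elems L N" "A' \<subseteq> elems L N" using A A' by (auto simp: small_def)
  have notin: "dfn ?srt ?V A' (\<lambda>\<rho>. \<forall>t\<in>D. \<not> (\<forall>i\<in>{0..<?n}. \<rho> i = t ! i))"
  proof (intro dfn_Ball dfn_neg D(2))
    fix t i assume t: "t \<in> D" and i: "i \<in> {0..<?n}"
    then have tt: "t \<in> tuples N Y" using DY by blast
    then have "Y = map sort_of t" "length t = ?n" using tuples_sorts(1)[OF _ Y] length_tuples by auto
    then have "Y ! i = sort_of (t ! i)" using i by (metis atLeastLessThan_iff nth_map)
    moreover have "t ! i \<in> set t" using i \<open>length t = ?n\<close> by simp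
    then have "t ! i \<in> A'" using t by (auto simp: A'_def)
    ultimately show "dfn ?srt ?V A' (\<lambda>\<rho>. \<rho> i = t ! i)"
      using i Ae by (intro dfn_eq_param) auto
  qed auto
  have notin_iff: "(\<forall>t\<in>D. \<not> (\<forall>i\<in>{0..<?n}. \<rho> i = t ! i)) \<longleftrightarrow> map \<rho> [0..<?n] \<notin> D" for \<rho>
  proof -
    have "(\<forall>i\<in>{0..<?n}. \<rho> i = t ! i) \<longleftrightarrow> map \<rho> [0..<?n] = t" if "t \<in> D" for t
    proof -
      have "t \<in> tuples N Y" using DY \<open>t \<in> D\<close> by blast
      then have "length t = ?n" by (rule length_tuples)
      then have "map ((!) t) [0..<?n] = t" by (simp only: map_nth flip: \<open>length t = ?n\<close>)
      moreover have "(\<forall>i\<in>{0..<?n}. \<rho> i = t ! i) \<longleftrightarrow> map \<rho> [0..<?n] = map ((!) t) [0..<?n]"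
        by (simp only: map_eq_conv set_upt)
      ultimately show ?thesis by (simp only:)
    qed
    then have "(\<forall>t\<in>D. \<not> (\<forall>i\<in>{0..<?n}. \<rho> i = t ! i)) \<longleftrightarrow> (\<forall>t\<in>D. map \<rho> [0..<?n] \<noteq> t)"
      by (intro ball_cong refl) (simp only: not_False_eq_True)
    then show ?thesis by blast
  qed
  define P where "P \<phi>c = (\<lambda>\<rho>. map \<rho> [0..<?n] \<in> realisations N Y {\<phi>c})" for \<phi>c
  have P: "dfn ?srt ?V A (P \<phi>c)" if "\<phi>c \<in> tp L N Y d A" for \<phi>c
  proof -
    have "\<phi>c \<in> Fm_over L N (map ?srt [0..<?n]) A" using that by (simp add: tp_def eq)
    from Fm_over_imp_dfn[OF this] show ?thesis by (simp only: P_def eq)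
  qed
  have P': "dfn ?srt ?V A' (\<lambda>\<rho>. P \<phi>c \<rho> \<and> map \<rho> [0..<?n] \<notin> D)" if "\<phi>c \<in> tp L N Y d A" for \<phi>c
  proof -
    have "A \<subseteq> A'" by (simp add: A'_def)
    from dfn_conj[OF dfn_mono[OF P[OF that] order_refl this] notin]
    show ?thesis by (simp only: notin_iff)
  qed
  have "\<exists>\<rho>\<in>Env ?srt ?V. \<forall>Q\<in>(\<lambda>\<phi>c \<rho>. P \<phi>c \<rho> \<and> map \<rho> [0..<?n] \<notin> D) ` tp L N Y d A. Q \<rho>"
  proof (rule many_variable_saturation[OF _ _ A'])
    show "|?V| <o \<kappa>" by (rule finite_ordLess_kappa) simp
    show "?srt ` ?V \<subseteq> Sorts L" using Y by auto
  next
    fix Q assume "Q \<in> (\<lambda>\<phi>c \<rho>. P \<phi>c \<rho> \<and> map \<rho> [0..<?n] \<notin> D) ` tp L N Y d A"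
    then show "dfn ?srt ?V A' Q" using P' by auto
  next
    fix q assume q: "q \<subseteq> (\<lambda>\<phi>c \<rho>. P \<phi>c \<rho> \<and> map \<rho> [0..<?n] \<notin> D) ` tp L N Y d A" "finite q"
    then obtain I where I: "I \<subseteq> tp L N Y d A" "finite I"
      "q = (\<lambda>\<phi>c \<rho>. P \<phi>c \<rho> \<and> map \<rho> [0..<?n] \<notin> D) ` I"
      using finite_subset_image[OF q(2,1)] by blast
    have "dfn ?srt ?V A (\<lambda>\<rho>. \<forall>\<phi>c\<in>I. P \<phi>c \<rho>)"
      using I P by (intro dfn_Ball) auto
    then obtain \<psi> where \<psi>: "\<psi> \<in> Fm_over L N (map ?srt [0..<?n]) A"
      "\<And>\<rho>. \<rho> \<in> Env ?srt ?V \<Longrightarrow>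
        map \<rho> [0..<?n] \<in> realisations N (map ?srt [0..<?n]) {\<psi>} \<longleftrightarrow> (\<forall>\<phi>c\<in>I. P \<phi>c \<rho>)"
      by (rule dfn_imp_Fm_over) (use Y Ae in auto)
    have "\<forall>\<phi>c\<in>I. P \<phi>c ((!) d)"
      using I(1) unfolding P_def map_nth_tuple[OF d] by (meson mem_tp subsetD)
    then have "d \<in> realisations N Y {\<psi>}"
      using \<psi>(2)[OF nth_tuple_Env[OF d]] by (simp only: map_nth_tuple[OF d] eq)
    then have "infinite (realisations N Y {\<psi>})"
      using nonalg \<psi>(1)[unfolded eq] unfolding algebraic_type_def algebraic_def tp_def by blast
    then obtain t where t: "t \<in> realisations N Y {\<psi>}" "t \<notin> D"
      using D(2) by (meson finite_subset subsetI)
    then have tt: "t \<in> tuples N Y" by (simp add: realisations_def)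
    have "\<forall>\<phi>c\<in>I. P \<phi>c ((!) t)"
      using \<psi>(2)[OF nth_tuple_Env[OF tt]] t(1) by (simp only: map_nth_tuple[OF tt] eq)
    then have "\<forall>Q\<in>q. Q ((!) t)" using t(2) by (auto simp: I(3) map_nth_tuple[OF tt])
    then show "\<exists>\<rho>\<in>Env ?srt ?V. \<forall>Q\<in>q. Q \<rho>" using nth_tuple_Env[OF tt] by blast
  qed
  then obtain \<rho> where \<rho>: "\<rho> \<in> Env ?srt ?V"
    "\<And>\<phi>c. \<phi>c \<in> tp L N Y d A \<Longrightarrow> P \<phi>c \<rho> \<and> map \<rho> [0..<?n] \<notin> D" by auto
  let ?t = "map \<rho> [0..<?n]"
  have "?t \<in> tuples N (map ?srt [0..<?n])" using \<rho>(1) by (simp only: tuples_map_iff Env_def mem_Collect_eq)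
  then have tt: "?t \<in> tuples N Y" by (simp only: eq)
  then have t: "?t \<in> realisations N Y (tp L N Y d A)"
    using \<rho>(2) unfolding realisations_tp P_def mem_tp by blast
  moreover have "?t \<notin> D"
  proof -
    \<comment> \<open>The condition of avoiding \<open>D\<close> was attached to each member of the
      type, so it takes effect only if there is a member; a true formula provides one.\<close>
    have "dfn ?srt ?V A (\<lambda>\<rho>. True)" by (rule dfn_True)
    then obtain \<psi> where "\<psi> \<in> Fm_over L N (map ?srt [0..<?n]) A"
      "\<And>\<rho>. \<rho> \<in> Env ?srt ?V \<Longrightarrow> map \<rho> [0..<?n] \<in> realisations N (map ?srt [0..<?n]) {\<psi>} \<longleftrightarrow> True"
      by (rule dfn_imp_Fm_over) (use Y Ae in auto)
    then have "\<psi> \<in> tp L N Y d A"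
      using nth_tuple_Env[OF d] unfolding mem_tp eq by (metis map_nth_tuple[OF d])
    then show ?thesis using \<rho>(2) by blast
  qed
  ultimately show ?case
    using D by (intro exI[of _ "insert ?t D"]) auto
qed

text \<open>Formulas with parameters list the variables first. To read \<open>\<psi>(x,d)\<close> as
  a condition on \<open>d\<close> with parameters from \<open>x\<close>, the two blocks must be
  exchanged.\<close>

lemma swap_variables:
  assumes "\<phi> \<in> Fm L (X @ Y)"
  obtains \<phi>' where "\<phi>' \<in> Fm L (Y @ X)"
    and "\<And>a b. length a = length X \<Longrightarrow> length b = length Y \<Longrightarrow> sat N (b @ a) \<phi>' \<longleftrightarrow> sat N (a @ b) \<phi>"
proof -
  let ?x = "map Inl [0..<length X]" and ?y = "map Inr [0..<length Y]"
  let ?\<tau> = "case_sum ((!) X) ((!) Y)"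
  have maps': "map ?\<tau> ?x = X" "map ?\<tau> ?y = Y"
    by (auto simp: comp_def map_nth intro: nth_equalityI)
  have 1: "\<phi> \<in> Fm L (map ?\<tau> (?x @ ?y))" using assms by (simp only: map_append maps')
  have 2: "?\<tau> ` set (?y @ ?x) \<subseteq> Sorts L" using assms by (auto simp: Fm_def)
  obtain \<phi>' where \<phi>': "\<phi>' \<in> Fm L (map ?\<tau> (?y @ ?x))"
    "\<And>\<eta>. sat N (map \<eta> (?y @ ?x)) \<phi>' \<longleftrightarrow> sat N (map \<eta> (?x @ ?y)) \<phi>"
    by (rule rename_variables[where M = N, OF 1 _ 2]) (auto intro: that)
  show ?thesis
  proof
    show "\<phi>' \<in> Fm L (Y @ X)" using \<phi>'(1) by (simp only: map_append maps')
    fix a b :: "'a list" assume "length a = length X" "length b = length Y"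
    then have "map (case_sum ((!) a) ((!) b)) ?x = a" "map (case_sum ((!) a) ((!) b)) ?y = b"
      by (auto simp: comp_def map_nth intro: nth_equalityI)
    then show "sat N (b @ a) \<phi>' \<longleftrightarrow> sat N (a @ b) \<phi>"
      using \<phi>'(2)[of "case_sum ((!) a) ((!) b)"] by (simp only: map_append)
  qed
qed

lemma realisations_tp_sat:
  assumes \<psi>: "\<psi> \<in> Fm L (X @ Z)" and a: "a \<in> tuples N X" "set a \<subseteq> A" and sat: "sat N (a @ d) \<psi>"
    and d: "d \<in> tuples N Z" and t: "t \<in> realisations N Z (tp L N Z d A)"
  shows "sat N (a @ t) \<psi>"
proof -
  obtain \<psi>' where \<psi>': "\<psi>' \<in> Fm L (Z @ X)"
    "\<And>a b. length a = length X \<Longrightarrow> length b = length Z \<Longrightarrow> sat N (b @ a) \<psi>' \<longleftrightarrow> sat N (a @ b) \<psi>"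
    by (rule swap_variables[OF \<psi>]) (rule that)
  have tt: "t \<in> tuples N Z" using t by (simp add: realisations_def)
  have "(\<psi>', a) \<in> Fm_over L N Z A" using \<psi>'(1) a by (auto simp: Fm_over_def)
  moreover have "d \<in> realisations N Z {(\<psi>', a)}"
    using sat d \<psi>'(2)[OF length_tuples[OF a(1)] length_tuples[OF d]] by (simp add: realisations_single)
  ultimately have "t \<in> realisations N Z {(\<psi>', a)}" using t unfolding realisations_tp by blast
  then show ?thesis
    using \<psi>'(2)[OF length_tuples[OF a(1)] length_tuples[OF tt]] by (simp add: realisations_single)
qed

section \<open>Thorn-independence\<close>

lemma thorn_indep_imp_not_thorn_forks:
  assumes indep: "thorn_indep L \<kappa> N A B C" and B: "small L \<kappa> N B" and C: "small L \<kappa> N C"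
    and a: "a \<in> tuples N X" "set a \<subseteq> A" and b: "b \<in> tuples N Y" "set b \<subseteq> B \<union> C"
    and \<phi>: "\<phi> \<in> Fm L (X @ Y)" "sat N (a @ b) \<phi>"
  shows "\<not> thorn_forks L N X Y \<phi> b C"
proof
  assume "thorn_forks L N X Y \<phi> b C"
  then obtain \<Psi> where fin: "finite \<Psi>"
    and \<Psi>0: "\<forall>(Z, \<psi>, d)\<in>\<Psi>. \<psi> \<in> Fm L (X @ Z) \<and> d \<in> tuples N Z \<and> thorn_divides L N X Z \<psi> d C"
    and cover: "\<forall>a\<in>tuples N X. sat N (a @ b) \<phi> \<longrightarrow> (\<exists>(Z, \<psi>, d)\<in>\<Psi>. sat N (a @ d) \<psi>)"
    unfolding thorn_forks_def by (elim exE conjE) (rule that)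
  have \<Psi>: "\<psi> \<in> Fm L (X @ Z) \<and> d \<in> tuples N Z \<and> thorn_divides L N X Z \<psi> d C"
    if "(Z, \<psi>, d) \<in> \<Psi>" for Z \<psi> d
    using bspec[OF \<Psi>0 that] by simp
  have X: "set X \<subseteq> Sorts L" using \<phi>(1) by (simp add: Fm_def)
  \<comment> \<open>The parameters \<open>c\<close> of all disjuncts are fixed in advance: they must
    lie in \<open>B'\<close> before it is known which disjunct the conjugate of \<open>a\<close>
    satisfies. There are finitely many, so \<open>B'\<close> stays small.\<close>
  define c where "c = (\<lambda>(Z, \<psi>, d). SOME c. set c \<subseteq> elems L N \<and> strongly_divides L N X Z \<psi> d (C \<union> set c))"
  have c: "set (c (Z, \<psi>, d)) \<subseteq> elems L N \<and> strongly_divides L N X Z \<psi> d (C \<union> set (c (Z, \<psi>, d)))"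
    if \<psi>: "(Z, \<psi>, d) \<in> \<Psi>" for Z \<psi> d
  proof -
    have "\<exists>c. set c \<subseteq> elems L N \<and> strongly_divides L N X Z \<psi> d (C \<union> set c)"
      using \<Psi>[OF \<psi>] by (simp add: thorn_divides_def)
    then show ?thesis unfolding c_def prod.case by (rule someI_ex)
  qed
  define E where "E = (\<Union>(Z, \<psi>, d)\<in>\<Psi>. set d \<union> set (c (Z, \<psi>, d)))"
  have d_elems: "set d \<subseteq> elems L N" if \<psi>: "(Z, \<psi>, d) \<in> \<Psi>" for Z \<psi> d
    using \<Psi>[OF \<psi>] tuples_sorts(2)[of d Z] by (simp add: Fm_def)
  have "E \<subseteq> elems L N" unfolding E_def
  proof (rule UN_least)
    fix i assume i: "i \<in> \<Psi>"
    obtain Z \<psi> d where "i = (Z, \<psi>, d)" by (cases i)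
    then show "(case i of (Z, \<psi>, d) \<Rightarrow> set d \<union> set (c (Z, \<psi>, d))) \<subseteq> elems L N"
      using i c[of Z \<psi> d] d_elems[of Z \<psi> d] by simp
  qed
  moreover have "finite E" using fin by (auto simp: E_def)
  ultimately have "small L \<kappa> N E" by (simp add: small_def finite_ordLess_kappa)
  define B' where "B' = B \<union> E"
  have B': "small L \<kappa> N B'" unfolding B'_def using B \<open>small L \<kappa> N E\<close> by (rule small_Un)
  then obtain g where g: "automorphism L N g" "\<forall>b\<in>B \<union> C. g b = b" "M_indep L N (g ` A) B' C"
    using indep unfolding thorn_indep_def conjugate_over_def by (auto simp: B'_def)
  define a' where "a' = map g a"
  have a': "a' \<in> tuples N X" "set a' \<subseteq> g ` A"
    unfolding a'_def using tuples_map_automorphism[OF g(1) a(1) X] a(2) by auto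
  have "map g b = b" using b(2) g(2) by (intro map_idI) blast
  then have eq: "map g (a @ b) = a' @ b" by (simp add: a'_def)
  have "a @ b \<in> tuples N (X @ Y)" using a(1) b(1) tuples_append[OF length_tuples[OF a(1)]] by blast
  then have "sat N (a' @ b) \<phi>"
    using sat_automorphism[OF lang struc g(1), of "a @ b" "X @ Y" \<phi>] \<phi> unfolding eq Fm_def by blast
  then obtain Z \<psi> d where \<psi>: "(Z, \<psi>, d) \<in> \<Psi>" "sat N (a' @ d) \<psi>" using bspec[OF cover a'(1)] by auto
  have \<psi>F: "\<psi> \<in> Fm L (X @ Z)" and d: "d \<in> tuples N Z" using \<Psi>[OF \<psi>(1)] by auto
  have Z: "set Z \<subseteq> Sorts L" using \<psi>F by (simp add: Fm_def)
  \<comment> \<open>M-independence is applied over this base; it lies in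
    \<open>B' \<union> C\<close> because \<open>c\<close> was put into \<open>B'\<close>.\<close>
  define C' where "C' = C \<union> set (c (Z, \<psi>, d))"
  have sd: "strongly_divides L N X Z \<psi> d C'" using c[OF \<psi>(1)] by (simp add: C'_def)
  have dB': "set d \<subseteq> B'" "set (c (Z, \<psi>, d)) \<subseteq> B'"
    using \<psi>(1) by (auto simp: B'_def E_def)
  have Ce: "C \<subseteq> elems L N" and B'e: "B' \<subseteq> elems L N" using C B' by (auto simp: small_def)
  have C'_sub: "C' \<subseteq> B' \<union> C" using dB'(2) by (auto simp: C'_def)
  have C'e: "C' \<subseteq> elems L N" using C'_sub Ce B'e by blast
  have "C' \<subseteq> acl L N (B' \<union> C)" using C'_sub subset_acl[of "B' \<union> C"] Ce B'e by blast
  then have M: "acl L N (g ` A \<union> C') \<inter> acl L N (B' \<union> C') = acl L N C'"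
    using g(3)[unfolded M_indep_def, rule_format, of C'] by (auto simp: C'_def)
  have a'e: "set a' \<subseteq> elems L N" using tuples_sorts(2)[OF a'(1) X] .
  have small: "small L \<kappa> N (C' \<union> set a')"
  proof (rule small_Un)
    show "small L \<kappa> N (set a')" using a'e by (simp add: small_def finite_ordLess_kappa)
    have "small L \<kappa> N (set (c (Z, \<psi>, d)))"
      using c[OF \<psi>(1)] by (simp add: small_def finite_ordLess_kappa)
    then show "small L \<kappa> N C'" unfolding C'_def by (rule small_Un[OF C])
  qed
  \<comment> \<open>Otherwise saturation gives \<open>k\<close> distinct realisations of the type of
    \<open>d\<close> over \<open>C'\<close> and \<open>a'\<close>. They realise its type over
    \<open>C'\<close> as well, and their instances of \<open>\<psi>\<close> have the common solution
    \<open>a'\<close>, against \<open>k\<close>-inconsistency.\<close>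
  have "algebraic_type N Z (tp L N Z d (C' \<union> set a'))"
  proof (rule ccontr)
    assume nonalg: "\<not> algebraic_type N Z (tp L N Z d (C' \<union> set a'))"
    obtain k where k: "\<forall>D \<subseteq> realisations N Z (tp L N Z d C'). finite D \<and> card D = k \<longrightarrow>
        \<not> (\<exists>a\<in>tuples N X. \<forall>b'\<in>D. sat N (a @ b') \<psi>)"
      using sd unfolding strongly_divides_def by (elim conjE exE) (rule that)
    obtain D where D: "D \<subseteq> realisations N Z (tp L N Z d (C' \<union> set a'))" "finite D" "card D = k"
      using nonalgebraic_tp_realisations[OF nonalg d Z small] by blast
    have "D \<subseteq> realisations N Z (tp L N Z d C')"
      using D(1) realisations_tp_antimono[of C' "C' \<union> set a'" Z d] by blast
    moreover have "sat N (a' @ t) \<psi>" if "t \<in> D" for t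
      using D(1) that by (intro realisations_tp_sat[OF \<psi>F a'(1) _ \<psi>(2) d, of "C' \<union> set a'"]) auto
    ultimately show False using k[rule_format, of D] D(2,3) a'(1) by blast
  qed
  then have "set d \<subseteq> acl L N (C' \<union> set a')"
    using a'e C'e by (intro algebraic_tp_imp_acl) auto
  also have "\<dots> \<subseteq> acl L N (g ` A \<union> C')" using a'(2) by (intro acl_mono) auto
  finally have "set d \<subseteq> acl L N (g ` A \<union> C')" .
  moreover have "set d \<subseteq> acl L N (B' \<union> C')" using dB'(1) subset_acl[of "B' \<union> C'"] B'e C'e by blast
  ultimately have "set d \<subseteq> acl L N C'" using M by blast
  then have "algebraic_type N Z (tp L N Z d C')" by (rule acl_imp_algebraic_tp[OF _ d Z C'e])
  then show False using sd by (simp add: strongly_divides_def)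
qed

text \<open>
  An element \<open>e\<close> of \<open>acl(AC') \<inter> acl(BC')\<close> outside \<open>acl C'\<close> is a solution of some \<open>\<chi>(y,a,c')\<close>
  with exactly \<open>k\<close> solutions.  The formula \<open>\<psi>(x,yz)\<close> saying that \<open>y\<close> is one of at most \<open>k\<close>
  solutions of \<open>\<chi>(y,x,z)\<close> then strongly divides at \<open>ec'\<close> over \<open>Cc'\<close>: the realisations of
  \<open>tp(ec'/Cc')\<close> differ only in \<open>y\<close>, so no \<open>a\<close> satisfies \<open>k + 1\<close> instances.
\<close>

lemma M_indep_if_no_dividing_formula:
  assumes A: "A \<subseteq> elems L N" and B: "B \<subseteq> elems L N" and C: "C \<subseteq> elems L N"
    and nodiv: "\<And>\<psi> a d. set a \<subseteq> A \<Longrightarrow> set d \<subseteq> acl L N (acl L N (B \<union> C)) \<Longrightarrow>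
      \<psi> \<in> Fm L (map sort_of a @ map sort_of d) \<Longrightarrow>
      thorn_divides L N (map sort_of a) (map sort_of d) \<psi> d C \<Longrightarrow> \<not> sat N (a @ d) \<psi>"
  shows "M_indep L N A B C"
  unfolding M_indep_def
proof (intro allI impI, rule ccontr)
  fix C' assume C': "C \<subseteq> C' \<and> C' \<subseteq> acl L N (B \<union> C)"
    and neq: "acl L N (A \<union> C') \<inter> acl L N (B \<union> C') \<noteq> acl L N C'"
  have "acl L N C' \<subseteq> acl L N (A \<union> C') \<inter> acl L N (B \<union> C')"
    using acl_mono[of C' "A \<union> C'"] acl_mono[of C' "B \<union> C'"] by blast
  then obtain e where e: "e \<in> acl L N (A \<union> C')" "e \<in> acl L N (B \<union> C')" "e \<notin> acl L N C'"
    using neq by blast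
  have C'e: "C' \<subseteq> elems L N" using C' acl_subset_elems by blast
  have BC: "B \<union> C \<subseteq> acl L N (B \<union> C)" using B C by (intro subset_acl) simp
  obtain s \<phi> m where s: "s \<in> Sorts L" "(\<phi>, m) \<in> Fm_over L N [s] (A \<union> C')"
    "finite (realisations N [s] {(\<phi>, m)})" "[e] \<in> realisations N [s] {(\<phi>, m)}"
    using e(1) unfolding acl_def algebraic_def by auto
  have e_carrier: "e \<in> carrier N s" and sat_e: "sat N (e # m) \<phi>"
    using s(4) by (auto simp: realisations_def tuples_def)
  have sort_e: "sort_of e = s" using sort_of_eq[OF s(1) e_carrier] .
  obtain \<Gamma> where \<Gamma>: "\<phi> \<in> Fm L ([s] @ \<Gamma>)" "m \<in> tuples N \<Gamma>" "set m \<subseteq> A \<union> C'"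
    using s(2) by (auto simp: Fm_over_def)
  have me: "set m \<subseteq> elems L N" using \<Gamma>(3) A C'e by blast
  have \<Gamma>_eq: "\<Gamma> = map sort_of m" using tuples_sorts(1)[OF \<Gamma>(2)] \<Gamma>(1) by (simp add: Fm_def)
  \<comment> \<open>\<open>None\<close> is the variable \<open>y\<close>, and \<open>Some u\<close>
    stands for the entry \<open>u\<close> of \<open>m\<close>, so repeated entries share a
    variable.\<close>
  define srt where "srt = case_option s sort_of"
  define V where "V = insert None (Some ` set m)"
  define P where "P \<rho> \<longleftrightarrow> sat N (\<rho> None # map (\<lambda>u. \<rho> (Some u)) m) \<phi>" for \<rho> :: "'a option \<Rightarrow> 'a"
  have P: "dfn srt V {} P"
  proof -
    have "dfn srt V {} (\<lambda>\<rho>. sat N (map (case_sum \<rho> id) (map Inl (None # map Some m))) \<phi>)"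
      using \<Gamma>(1) unfolding \<Gamma>_eq by (intro dfn_formula) (auto simp: srt_def V_def comp_def)
    then show ?thesis by (rule dfn_cong) (simp add: P_def comp_def)
  qed
  define K where "K = {y \<in> carrier N s. sat N (y # m) \<phi>}"
  have "(\<lambda>y. [y]) ` K \<subseteq> realisations N [s] {(\<phi>, m)}" by (auto simp: K_def realisations_def tuples_def)
  then have "finite ((\<lambda>y. [y]) ` K)" using s(3) finite_subset by blast
  then have finK: "finite K" by (rule finite_imageD) (simp add: inj_on_def)
  \<comment> \<open>Excluding \<open>Suc (card K)\<close> solutions is true of the actual
    parameters, whose solution set is \<open>K\<close>. Built into \<open>\<psi>\<close>, it gives a
    bound uniform in \<open>x\<close>, hence the \<open>Suc (card K)\<close>-inconsistency.\<close>
  define few where "few \<rho> \<longleftrightarrow> \<not> (\<exists>K' \<subseteq> {y \<in> carrier N (srt None). P (\<rho>(None := y))}.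
    finite K' \<and> card K' = Suc (card K))" for \<rho>
  have "dfn srt (V - {None}) {} few"
    unfolding few_def using s(1) by (intro dfn_neg dfn_card[OF P]) (simp_all add: srt_def)
  then have "dfn srt V {} few" by (rule dfn_mono) auto
  then have PQ: "dfn srt V {} (\<lambda>\<rho>. P \<rho> \<and> few \<rho>)" by (rule dfn_conj[OF P])
  \<comment> \<open>The tuple \<open>m\<close> mixes elements of \<open>A\<close> and
    \<open>C'\<close>. Entries in \<open>A\<close> go to the \<open>x\<close> side, and the others,
    all in \<open>C'\<close>, become \<open>c\<close>. Without repetitions, any tuple of the right
    length defines an assignment on \<open>vs\<close>.\<close>
  obtain a where a: "set a = set m \<inter> A" "distinct a" using finite_distinct_list[of "set m \<inter> A"] by auto
  obtain c where c: "set c = set m - A" "distinct c" using finite_distinct_list[of "set m - A"] by auto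
  have cC': "set c \<subseteq> C'" using c(1) \<Gamma>(3) by blast
  define vs where "vs = map Some a @ None # map Some c"
  have vs: "distinct vs" "set vs = V"
    using a c by (auto simp: vs_def V_def distinct_map)
  have srt_vs: "map srt vs = map sort_of a @ map sort_of (e # c)"
    by (simp add: vs_def srt_def sort_e)
  have ace: "set (a @ e # c) \<subseteq> elems L N"
    using a(1) c(1) me in_elems[OF s(1) e_carrier] by auto
  have srt_V: "srt ` set vs \<subseteq> Sorts L" using me s(1) sort_of(1) by (auto simp: vs(2) V_def srt_def)
  have "dfn srt (set vs) {} (\<lambda>\<rho>. P \<rho> \<and> few \<rho>)" using PQ vs(2) by simp
  then obtain \<psi>c where \<psi>c: "\<psi>c \<in> Fm_over L N (map srt vs) {}"
    "\<And>\<rho>. \<rho> \<in> Env srt (set vs) \<Longrightarrow>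
      map \<rho> vs \<in> realisations N (map srt vs) {\<psi>c} \<longleftrightarrow> P \<rho> \<and> few \<rho>"
    by (rule dfn_imp_Fm_over[OF _ srt_V empty_subsetI]) (rule that)
  obtain \<psi> where \<psi>: "\<psi>c = (\<psi>, [])" "\<psi> \<in> Fm L (map sort_of a @ map sort_of (e # c))"
    using \<psi>c(1) unfolding Fm_over_def srt_vs by (auto simp: tuples_def)
  have sat_\<psi>: "sat N t \<psi> \<longleftrightarrow> P \<rho> \<and> few \<rho>"
    if t: "map \<rho> vs = t" "t \<in> tuples N (map sort_of a @ map sort_of (e # c))" for \<rho> t
  proof -
    have tt: "map \<rho> vs \<in> tuples N (map srt vs)" using t by (simp only: srt_vs)
    then have "\<rho> \<in> Env srt (set vs)" unfolding tuples_map_iff Env_def by blast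
    from \<psi>c(2)[OF this] show ?thesis using tt t(1) by (simp add: \<psi>(1) realisations_single)
  qed
  have ac_tuple: "a @ e # c \<in> tuples N (map sort_of a @ map sort_of (e # c))"
    using tuples_sort_of[OF ace] by simp
  have "sat N (a @ e # c) \<psi>"
  proof -
    let ?\<rho> = "case_option e id"
    have eq: "map ?\<rho> vs = a @ e # c" by (simp add: vs_def comp_def)
    have "P ?\<rho>" using sat_e by (simp add: P_def)
    have "{y \<in> carrier N (srt None). P (?\<rho>(None := y))} = K"
      by (simp add: P_def srt_def K_def)
    then have "few ?\<rho>" unfolding few_def by (metis card_mono[OF finK] not_less_eq_eq order_refl)
    then show ?thesis using sat_\<psi>[OF eq ac_tuple] \<open>P ?\<rho>\<close> by blast
  qed
  moreover have "thorn_divides L N (map sort_of a) (map sort_of (e # c)) \<psi> (e # c) C"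
    unfolding thorn_divides_def strongly_divides_def
  proof (intro exI[of _ c] conjI exI[of _ "Suc (card K)"] allI impI notI)
    let ?Y = "map sort_of (e # c)"
    show "set c \<subseteq> elems L N" using ace by simp
    have ec: "e # c \<in> tuples N ?Y" using ace by (intro tuples_sort_of) auto
    have Y: "set ?Y \<subseteq> Sorts L" using ace sort_of(1) by auto
    {
      assume "algebraic_type N ?Y (tp L N ?Y (e # c) (C \<union> set c))"
      then have "e \<in> acl L N (C \<union> set c)"
        using algebraic_tp_Cons_imp_acl[of "sort_of e" "map sort_of c" e c] by simp
      moreover have "C \<union> set c \<subseteq> C'" using C' cC' by blast
      ultimately show False using acl_mono e(3) by blast
    }
    fix D
    assume D: "D \<subseteq> realisations N ?Y (tp L N ?Y (e # c) (C \<union> set c))"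
      "finite D \<and> card D = Suc (card K)" and x: "\<exists>x\<in>tuples N (map sort_of a). \<forall>b'\<in>D. sat N (x @ b') \<psi>"
    obtain x where x: "x \<in> tuples N (map sort_of a)" "\<And>t. t \<in> D \<Longrightarrow> sat N (x @ t) \<psi>"
      using x by blast
    have D_Cons: "t = hd t # c \<and> hd t \<in> carrier N s \<and> t \<in> tuples N ?Y" if t: "t \<in> D" for t
    proof -
      have real: "t \<in> realisations N ?Y (tp L N ?Y (e # c) (C \<union> set c))" using D(1) t by blast
      then have tt: "t \<in> tuples N ?Y" by (simp add: realisations_def)
      then obtain y z where yz: "t = y # z" "y \<in> carrier N s" "length z = length c"
        by (auto simp: tuples_def list_all2_Cons2 sort_e dest: list_all2_lengthD)
      have "z ! i = c ! i" if "i < length c" for i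
        using realisations_tp_nth[OF real ec Y, of "Suc i"] ace C that yz(1) by auto
      then have "z = c" using yz(3) by (intro nth_equalityI) auto
      then show ?thesis using yz tt by simp
    qed
    define K' where "K' = hd ` D"
    have "inj_on hd D" using D_Cons by (metis inj_onI)
    then have K': "finite K'" "card K' = Suc (card K)" using D(2) by (auto simp: K'_def card_image)
    then obtain t0 where t0: "t0 \<in> D" by (force simp: K'_def)
    have len: "length (x @ t) = length vs" if "t \<in> D" for t
      using length_tuples[OF x(1)] D_Cons[OF that] length_tuples[of t ?Y] by (simp add: vs_def)
    obtain \<rho> where \<rho>: "map \<rho> vs = x @ t0" by (rule ex_assignment[OF vs(1) len[OF t0]]) (rule that)
    have xt: "x @ t \<in> tuples N (map sort_of a @ ?Y)" if "t \<in> D" for t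
      using x(1) D_Cons[OF that] tuples_append[OF length_tuples[OF x(1)]] by blast
    have lx: "length (map \<rho> (map Some a)) = length x" using length_tuples[OF x(1)] by simp
    have "map \<rho> (map Some a) @ \<rho> None # map \<rho> (map Some c) = x @ t0"
      using \<rho> by (simp add: vs_def)
    then have \<rho>x: "map \<rho> (map Some a) = x" "\<rho> None # map \<rho> (map Some c) = hd t0 # c"
      using lx D_Cons[OF t0] by (metis append_eq_append_conv)+
    have upd: "map (\<rho>(None := hd t)) vs = x @ t" if "t \<in> D" for t
    proof -
      have "map (\<rho>(None := hd t)) vs = map \<rho> (map Some a) @ hd t # map \<rho> (map Some c)"
        by (simp add: vs_def)
      also have "\<dots> = x @ hd t # c" using \<rho>x by simp
      finally show ?thesis using D_Cons[OF that] by metis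
    qed
    \<comment> \<open>\<open>few\<close> does not read the value at \<open>None\<close>, so the
      assignment built from the single member \<open>t0\<close> serves all of
      \<open>D\<close>.\<close>
    have "few \<rho>" using sat_\<psi>[OF \<rho> xt[OF t0]] x(2)[OF t0] by blast
    moreover have "K' \<subseteq> {y \<in> carrier N (srt None). P (\<rho>(None := y))}"
    proof
      fix y assume "y \<in> K'"
      then obtain t where t: "t \<in> D" "y = hd t" by (auto simp: K'_def)
      have "P (\<rho>(None := y))" using sat_\<psi>[OF upd[OF t(1)] xt[OF t(1)]] x(2)[OF t(1)] t(2) by blast
      then show "y \<in> {y \<in> carrier N (srt None). P (\<rho>(None := y))}"
        using D_Cons[OF t(1)] t(2) by (simp add: srt_def)
    qed
    ultimately show False using K' unfolding few_def by blast
  qed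
  moreover have "set (e # c) \<subseteq> acl L N (acl L N (B \<union> C))"
  proof -
    have "B \<union> C' \<subseteq> acl L N (B \<union> C)" using C' BC by blast
    then have "e \<in> acl L N (acl L N (B \<union> C))" using e(2) acl_mono by blast
    moreover have "set c \<subseteq> acl L N (acl L N (B \<union> C))"
      using cC' C' subset_acl[OF acl_subset_elems] by blast
    ultimately show ?thesis by simp
  qed
  ultimately show False using nodiv[of a "e # c" \<psi>] a(1) \<psi>(2) by blast
qed

text \<open>A common solution of instances of \<open>\<psi>'\<close> projects to a common solution
  of the same instances of \<open>\<psi>\<close>, so the same \<open>c\<close> and \<open>k\<close>
  work. This brings disjuncts with different \<open>x\<close> tuples to the one context demanded by
  thorn-forking.\<close>

lemma thorn_divides_dummy_variables:
  assumes div: "thorn_divides L N X Z \<psi> d C"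
    and proj: "\<And>t. t \<in> tuples N X' \<Longrightarrow>
      \<exists>x\<in>tuples N X. \<forall>z\<in>tuples N Z. sat N (t @ z) \<psi>' \<longrightarrow> sat N (x @ z) \<psi>"
  shows "thorn_divides L N X' Z \<psi>' d C"
proof -
  obtain c k where c: "set c \<subseteq> elems L N" "\<not> algebraic_type N Z (tp L N Z d (C \<union> set c))"
    and k: "\<forall>D \<subseteq> realisations N Z (tp L N Z d (C \<union> set c)). finite D \<and> card D = k \<longrightarrow>
        \<not> (\<exists>a\<in>tuples N X. \<forall>b'\<in>D. sat N (a @ b') \<psi>)"
    using div unfolding thorn_divides_def strongly_divides_def by (elim exE conjE) (rule that)
  have "\<not> (\<exists>t\<in>tuples N X'. \<forall>z\<in>D. sat N (t @ z) \<psi>')"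
    if D: "D \<subseteq> realisations N Z (tp L N Z d (C \<union> set c))" "finite D \<and> card D = k" for D
  proof
    assume "\<exists>t\<in>tuples N X'. \<forall>z\<in>D. sat N (t @ z) \<psi>'"
    then obtain t where t: "t \<in> tuples N X'" "\<forall>z\<in>D. sat N (t @ z) \<psi>'" by blast
    obtain x where x: "x \<in> tuples N X" "\<forall>z\<in>tuples N Z. sat N (t @ z) \<psi>' \<longrightarrow> sat N (x @ z) \<psi>"
      using proj[OF t(1)] by blast
    have "D \<subseteq> tuples N Z" using D(1) by (auto simp: realisations_def)
    then have "\<forall>z\<in>D. sat N (x @ z) \<psi>" using x(2) t(2) by blast
    then show False using k[rule_format, OF D] x(1) by blast
  qed
  then show ?thesis
    using c unfolding thorn_divides_def strongly_divides_def by (intro exI[of _ c] exI[of _ k] conjI allI impI)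
qed

text \<open>Each element of \<open>A\<close> is its own variable, and \<open>id\<close> is the
  assignment given by \<open>A\<close> itself. If the type over \<open>B\<close> with the negated
  dividing formulas were not finitely satisfiable, one formula true of a tuple from \<open>A\<close>
  would imply a finite disjunction of dividing formulas, that is, thorn-fork over
  \<open>C\<close>.\<close>

lemma not_thorn_forks_imp_realisable:
  assumes A: "small L \<kappa> N A" and B: "B \<subseteq> elems L N" and D: "small L \<kappa> N D" and BD: "B \<subseteq> D"
    and nofork: "\<And>X Y \<phi> a b. a \<in> tuples N X \<Longrightarrow> set a \<subseteq> A \<Longrightarrow> b \<in> tuples N Y \<Longrightarrow> set b \<subseteq> B \<Longrightarrow>
      \<phi> \<in> Fm L (X @ Y) \<Longrightarrow> sat N (a @ b) \<phi> \<Longrightarrow> \<not> thorn_forks L N X Y \<phi> b C"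
  obtains \<rho> where "\<rho> \<in> Env sort_of A" and "\<And>P. dfn sort_of A B P \<Longrightarrow> P id \<Longrightarrow> P \<rho>"
    and "\<And>a d \<psi>. set a \<subseteq> A \<Longrightarrow> set d \<subseteq> D \<Longrightarrow> \<psi> \<in> Fm L (map sort_of a @ map sort_of d) \<Longrightarrow>
      thorn_divides L N (map sort_of a) (map sort_of d) \<psi> d C \<Longrightarrow> \<not> sat N (map \<rho> a @ d) \<psi>"
proof -
  have Ae: "A \<subseteq> elems L N" and De: "D \<subseteq> elems L N" using A D by (auto simp: small_def)
  define J where "J = {(\<psi>, a, d). set a \<subseteq> A \<and> set d \<subseteq> D \<and> \<psi> \<in> Fm L (map sort_of a @ map sort_of d) \<and>
    thorn_divides L N (map sort_of a) (map sort_of d) \<psi> d C}"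
  define f where "f = (\<lambda>(\<psi>, a, d) (\<rho> :: 'a \<Rightarrow> 'a). \<not> sat N (map \<rho> a @ d) \<psi>)"
  define p1 where "p1 = {P. dfn sort_of A B P \<and> P id}"
  have id_Env: "id \<in> Env sort_of A'" if "A' \<subseteq> A" for A'
    using sort_of(2) Ae that by (auto simp: Env_def)
  have "\<exists>\<rho>\<in>Env sort_of A. \<forall>P\<in>p1 \<union> f ` J. P \<rho>"
  proof (rule many_variable_saturation[OF _ _ D])
    show "|A| <o \<kappa>" using A by (simp add: small_def)
    show "sort_of ` A \<subseteq> Sorts L" using Ae sort_of(1) by blast
  next
    fix P assume "P \<in> p1 \<union> f ` J"
    then show "dfn sort_of A D P"
    proof
      assume "P \<in> p1"
      then have "dfn sort_of A B P" by (simp add: p1_def)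
      then show ?thesis by (rule dfn_mono[OF _ order_refl BD])
    next
      assume "P \<in> f ` J"
      then obtain \<psi> a d where j: "P = f (\<psi>, a, d)" "(\<psi>, a, d) \<in> J" by auto
      have "dfn sort_of A D (\<lambda>\<rho>. sat N (map (case_sum \<rho> id) (map Inl a @ map Inr d)) \<psi>)"
        using j(2) by (intro dfn_formula) (auto simp: J_def comp_def)
      from dfn_neg[OF this] show ?thesis unfolding j(1)
        by (rule dfn_cong) (simp add: f_def comp_def)
    qed
  next
    fix q assume q: "q \<subseteq> p1 \<union> f ` J" "finite q"
    define q1 where "q1 = q \<inter> p1"
    have "q - p1 \<subseteq> f ` J" "finite (q - p1)" using q by auto
    then obtain I where I: "I \<subseteq> J" "finite I" "q - p1 = f ` I"
      by (meson finite_subset_image)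
    show "\<exists>\<rho>\<in>Env sort_of A. \<forall>P\<in>q. P \<rho>"
    proof (rule ccontr)
      assume unsat: "\<not> (\<exists>\<rho>\<in>Env sort_of A. \<forall>P\<in>q. P \<rho>)"
      have "dfn sort_of A B (\<lambda>\<rho>. \<forall>P\<in>q1. P \<rho>)"
        using q(2) by (intro dfn_Ball[where P = "\<lambda>P. P"]) (auto simp: q1_def p1_def)
      then obtain W Q where W: "finite W" "W \<subseteq> A" "dfn sort_of W B Q"
        and Q: "\<And>\<rho>. \<rho> \<in> Env sort_of A \<Longrightarrow> (\<forall>P\<in>q1. P \<rho>) \<longleftrightarrow> Q \<rho>"
        by (rule dfn_finite_support) (rule that)
      \<comment> \<open>All variables in the inconsistent finite part, listed once as
        \<open>xs\<close>: this becomes the common tuple \<open>x\<close>.\<close>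
      define U where "U = W \<union> (\<Union>(\<psi>, a, d)\<in>I. set a)"
      have "finite U" using W(1) I(2) by (auto simp: U_def)
      then obtain xs where xs: "set xs = U" "distinct xs" using finite_distinct_list by blast
      have UA: "U \<subseteq> A" using W(2) I(1) unfolding U_def J_def by fastforce
      let ?X = "map sort_of xs"
      have X: "set ?X \<subseteq> Sorts L" using sort_of(1) Ae UA xs(1) by auto
      have "dfn sort_of (set xs) B Q" using W(3) by (rule dfn_mono) (auto simp: xs U_def)
      then obtain \<phi>c where \<phi>c: "\<phi>c \<in> Fm_over L N ?X B"
        "\<And>\<rho>. \<rho> \<in> Env sort_of (set xs) \<Longrightarrow> map \<rho> xs \<in> realisations N ?X {\<phi>c} \<longleftrightarrow> Q \<rho>"
        by (rule dfn_imp_Fm_over) (use X B in auto)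
      obtain \<phi> b Y where \<phi>: "\<phi>c = (\<phi>, b)" "\<phi> \<in> Fm L (?X @ Y)" "b \<in> tuples N Y" "set b \<subseteq> B"
        using \<phi>c(1) by (auto simp: Fm_over_def)
      have "Q id" using Q[OF id_Env[OF order_refl]] by (auto simp: q1_def p1_def)
      then have "map id xs \<in> realisations N ?X {\<phi>c}" using \<phi>c(2)[of id] id_Env UA xs(1) by blast
      then have xs_real: "xs \<in> tuples N ?X" "sat N (xs @ b) \<phi>" by (simp_all add: \<phi>(1) realisations_single)
      have "\<not> thorn_forks L N ?X Y \<phi> b C"
        using xs_real(1) _ \<phi>(3,4,2) xs_real(2) by (rule nofork) (use UA xs(1) in simp)
      moreover have "thorn_forks L N ?X Y \<phi> b C"
      proof -
        have "\<exists>\<psi>'. \<psi>' \<in> Fm L (?X @ map sort_of d) \<and>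
            (\<forall>\<rho> z. length z = length d \<longrightarrow> (sat N (map \<rho> xs @ z) \<psi>' \<longleftrightarrow> sat N (map \<rho> a @ z) \<psi>))"
          if j: "(\<psi>, a, d) \<in> I" for \<psi> a d
        proof -
          have J: "set a \<subseteq> A" "set d \<subseteq> D" "\<psi> \<in> Fm L (map sort_of a @ map sort_of d)"
            using j I(1) by (auto simp: J_def)
          \<comment> \<open>The parameter slots are labelled by positions: \<open>d\<close> may
            repeat an element where another tuple \<open>z\<close> does not.\<close>
          let ?z = "map Inr [0..<length d]" and ?\<tau> = "case_sum sort_of (\<lambda>i. sort_of (d ! i))"
          have zmap: "map (\<lambda>i. z ! i) [0..<length d] = z" if "length z = length d" for z :: "'a list"
            using map_nth[of z] that by simp
          have "map (\<lambda>i. sort_of (d ! i)) [0..<length d] = map sort_of (map ((!) d) [0..<length d])" by simp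
          then have dmap: "map (\<lambda>i. sort_of (d ! i)) [0..<length d] = map sort_of d" by (simp only: map_nth)
          have 1: "\<psi> \<in> Fm L (map ?\<tau> (map Inl a @ ?z))" using J(3) by (simp add: comp_def dmap)
          have "set a \<subseteq> set xs" using j xs(1) unfolding U_def by fastforce
          then have 2: "set (map Inl a @ ?z) \<subseteq> set (map Inl xs @ ?z)" by auto
          have "sort_of (d ! i) \<in> Sorts L" if "i < length d" for i
            using J(2) De sort_of(1) nth_mem[OF that] by blast
          then have 3: "?\<tau> ` set (map Inl xs @ ?z) \<subseteq> Sorts L" using X by auto
          obtain \<psi>' where \<psi>': "\<psi>' \<in> Fm L (map ?\<tau> (map Inl xs @ ?z))"
            "\<And>\<eta>. sat N (map \<eta> (map Inl xs @ ?z)) \<psi>' \<longleftrightarrow> sat N (map \<eta> (map Inl a @ ?z)) \<psi>"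
            by (rule rename_variables[where M = N, OF 1 2 3]) (rule that)
          have "sat N (map \<rho> xs @ z) \<psi>' \<longleftrightarrow> sat N (map \<rho> a @ z) \<psi>" if "length z = length d" for \<rho> z
            using \<psi>'(2)[of "case_sum \<rho> ((!) z)"] by (simp add: comp_def zmap[OF that])
          then show ?thesis using \<psi>'(1) by (intro exI[of _ \<psi>']) (simp add: comp_def dmap)
        qed
        then have "\<forall>j\<in>I. \<exists>\<psi>'. case j of (\<psi>, a, d) \<Rightarrow> \<psi>' \<in> Fm L (?X @ map sort_of d) \<and>
            (\<forall>\<rho> z. length z = length d \<longrightarrow> (sat N (map \<rho> xs @ z) \<psi>' \<longleftrightarrow> sat N (map \<rho> a @ z) \<psi>))"
          by auto
        from bchoice[OF this] obtain dummy where dummy: "\<forall>j\<in>I. case j of (\<psi>, a, d) \<Rightarrow>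
            dummy j \<in> Fm L (?X @ map sort_of d) \<and> (\<forall>\<rho> z. length z = length d \<longrightarrow>
              (sat N (map \<rho> xs @ z) (dummy j) \<longleftrightarrow> sat N (map \<rho> a @ z) \<psi>))"
          by (rule exE)
        have dummyD: "dummy (\<psi>, a, d) \<in> Fm L (?X @ map sort_of d)"
          "\<And>\<rho> z. length z = length d \<Longrightarrow>
            sat N (map \<rho> xs @ z) (dummy (\<psi>, a, d)) \<longleftrightarrow> sat N (map \<rho> a @ z) \<psi>"
          if "(\<psi>, a, d) \<in> I" for \<psi> a d
          using bspec[OF dummy that] by simp_all
        define \<Psi> where "\<Psi> = (\<lambda>(\<psi>, a, d). (map sort_of d, dummy (\<psi>, a, d), d)) ` I"
        \<comment> \<open>The supposed inconsistency concerns assignments on all of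
          \<open>A\<close>, so a tuple for \<open>xs\<close> is extended by the identity.\<close>
        have assign: "\<exists>\<rho>\<in>Env sort_of A. map \<rho> xs = t" if t: "t \<in> tuples N ?X" for t
        proof -
          have "length t = length xs" using length_tuples[OF t] by simp
          then obtain \<rho> where \<rho>: "map \<rho> xs = t" "\<And>v. v \<notin> set xs \<Longrightarrow> \<rho> v = id v"
            by (rule ex_assignment[OF xs(2)]) (rule that)
          have "map \<rho> xs \<in> tuples N ?X" using t \<rho>(1) by simp
          then have "\<rho> \<in> Env sort_of (set xs)" unfolding tuples_map_iff Env_def by blast
          then have "\<rho> v \<in> carrier N (sort_of v)" if "v \<in> A" for v
            using \<rho>(2)[of v] sort_of(2)[of v] Ae that by (cases "v \<in> set xs") (auto simp: Env_def)
          then have "\<rho> \<in> Env sort_of A" by (simp add: Env_def)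
          then show ?thesis using \<rho>(1) by blast
        qed
        show ?thesis
          unfolding thorn_forks_def
        proof (intro exI[of _ \<Psi>] conjI ballI impI)
          show "finite \<Psi>" using I(2) by (simp add: \<Psi>_def)
        next
          fix i assume "i \<in> \<Psi>"
          then obtain \<psi> a d where i: "i = (map sort_of d, dummy (\<psi>, a, d), d)" and j: "(\<psi>, a, d) \<in> I"
            unfolding \<Psi>_def by force
          have J: "set a \<subseteq> set xs" "set d \<subseteq> D" "thorn_divides L N (map sort_of a) (map sort_of d) \<psi> d C"
            using j I(1) xs(1) unfolding U_def J_def by fastforce+
          have "d \<in> tuples N (map sort_of d)" using J(2) De by (intro tuples_sort_of) blast
          moreover have "thorn_divides L N ?X (map sort_of d) (dummy (\<psi>, a, d)) d C"
          proof (rule thorn_divides_dummy_variables[OF J(3)])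
            fix t assume t: "t \<in> tuples N ?X"
            obtain \<rho> where \<rho>: "\<rho> \<in> Env sort_of A" "map \<rho> xs = t" using assign[OF t] by blast
            have "map \<rho> a \<in> tuples N (map sort_of a)"
              using \<rho>(1) J(1) UA xs(1) by (auto simp: tuples_map_iff Env_def)
            moreover have "sat N (map \<rho> a @ z) \<psi>"
              if z: "z \<in> tuples N (map sort_of d)" "sat N (t @ z) (dummy (\<psi>, a, d))" for z
              using dummyD(2)[OF j, of z \<rho>] z length_tuples[OF z(1)] \<rho>(2) by simp
            ultimately show "\<exists>x\<in>tuples N (map sort_of a). \<forall>z\<in>tuples N (map sort_of d).
                sat N (t @ z) (dummy (\<psi>, a, d)) \<longrightarrow> sat N (x @ z) \<psi>" by blast
          qed
          ultimately show "case i of (Z, \<psi>, d) \<Rightarrow> \<psi> \<in> Fm L (?X @ Z) \<and> d \<in> tuples N Z \<and>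
              thorn_divides L N ?X Z \<psi> d C"
            using dummyD(1)[OF j] by (simp add: i)
        next
          fix t assume t: "t \<in> tuples N ?X" "sat N (t @ b) \<phi>"
          obtain \<rho> where \<rho>: "\<rho> \<in> Env sort_of A" "map \<rho> xs = t" using assign[OF t(1)] by blast
          have "\<rho> \<in> Env sort_of (set xs)" using \<rho>(1) UA xs(1) by (auto simp: Env_def)
          from \<phi>c(2)[OF this] have "Q \<rho>" using t by (simp add: \<rho>(2) \<phi>(1) realisations_single)
          then have "\<forall>P\<in>q1. P \<rho>" using Q[OF \<rho>(1)] by blast
          \<comment> \<open>By inconsistency some member of \<open>q\<close> fails. It is not in
            \<open>q1\<close>, so it is the negation of a dividing formula, which therefore
            holds.\<close>
          moreover obtain P where P: "P \<in> q" "\<not> P \<rho>" using unsat \<rho>(1) by blast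
          ultimately have "P \<in> f ` I" using I(3) by (auto simp: q1_def)
          then obtain \<psi> a d where j: "(\<psi>, a, d) \<in> I" "P = f (\<psi>, a, d)" by auto
          have "sat N (t @ d) (dummy (\<psi>, a, d))"
            using P(2) dummyD(2)[OF j(1), of d \<rho>] \<rho>(2) by (simp add: j(2) f_def)
          moreover have "(map sort_of d, dummy (\<psi>, a, d), d) \<in> \<Psi>" using j(1) unfolding \<Psi>_def by force
          ultimately show "\<exists>(Z, \<psi>, d)\<in>\<Psi>. sat N (t @ d) \<psi>" by blast
        qed
      qed
      ultimately show False by blast
    qed
  qed
  then obtain \<rho> where \<rho>: "\<rho> \<in> Env sort_of A" "\<forall>P\<in>p1 \<union> f ` J. P \<rho>" by blast
  show ?thesis
  proof
    show "\<rho> \<in> Env sort_of A" by fact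
    show "P \<rho>" if "dfn sort_of A B P" "P id" for P using \<rho>(2) that by (auto simp: p1_def)
    fix a d \<psi>
    assume "set a \<subseteq> A" "set d \<subseteq> D" "\<psi> \<in> Fm L (map sort_of a @ map sort_of d)"
      "thorn_divides L N (map sort_of a) (map sort_of d) \<psi> d C"
    then have "(\<psi>, a, d) \<in> J" by (simp add: J_def)
    then have "f (\<psi>, a, d) \<rho>" using \<rho>(2) by blast
    then show "\<not> sat N (map \<rho> a @ d) \<psi>" by (simp add: f_def)
  qed
qed

text \<open>The hypothesis transfers truth from \<open>id\<close> to \<open>\<rho>\<close> only, but
  definable predicates are closed under negation. So the map is elementary, and strong homogeneity
  extends it.\<close>

lemma automorphism_extending_assignment:
  assumes A: "small L \<kappa> N A" and B: "small L \<kappa> N B" and \<rho>: "\<rho> \<in> Env sort_of A"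
    and tp: "\<And>P. dfn sort_of A B P \<Longrightarrow> P id \<Longrightarrow> P \<rho>"
  obtains g where "automorphism L N g" and "\<And>b. b \<in> B \<Longrightarrow> g b = b" and "\<And>a. a \<in> A \<Longrightarrow> g a = \<rho> a"
proof -
  have Ae: "A \<subseteq> elems L N" and Be: "B \<subseteq> elems L N" using A B by (auto simp: small_def)
  define h where "h e = (if e \<in> A then \<rho> e else e)" for e
  have "elementary_map L N (A \<union> B) h"
    unfolding elementary_map_def
  proof (intro conjI allI ballI impI)
    fix s assume s: "s \<in> Sorts L"
    show "h ` ((A \<union> B) \<inter> carrier N s) \<subseteq> carrier N s"
      using \<rho> sort_of_eq[OF s] by (auto simp: h_def Env_def)
  next
    fix \<Gamma> \<phi> t assume \<phi>: "\<phi> \<in> Fm L \<Gamma>" and t: "t \<in> tuples N \<Gamma>" "set t \<subseteq> A \<union> B"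
    have \<Gamma>: "\<Gamma> = map sort_of t" using tuples_sorts(1)[OF t(1)] \<phi> by (simp add: Fm_def)
    let ?ws = "map (\<lambda>e. if e \<in> A then Inl e else Inr e) t"
    \<comment> \<open>An entry in both \<open>A\<close> and \<open>B\<close> is read as a variable
      here, in accordance with \<open>h\<close>.\<close>
    define P where "P \<sigma> \<longleftrightarrow> sat N (map (\<lambda>e. if e \<in> A then \<sigma> e else e) t) \<phi>" for \<sigma>
    have "map (case_sum sort_of sort_of) ?ws = \<Gamma>" by (simp add: \<Gamma>)
    then have "\<phi> \<in> Fm L (map (case_sum sort_of sort_of) ?ws)" using \<phi> by (simp only:)
    moreover have "set ?ws \<subseteq> A <+> B" using t(2) by auto
    ultimately have "dfn sort_of A B (\<lambda>\<sigma>. sat N (map (case_sum \<sigma> id) ?ws) \<phi>)"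
      by (rule dfn_formula)
    moreover have "map (case_sum \<sigma> id) ?ws = map (\<lambda>e. if e \<in> A then \<sigma> e else e) t" for \<sigma> :: "'a \<Rightarrow> 'a"
      by simp
    ultimately have P: "dfn sort_of A B P" unfolding P_def by (simp only:)
    have "P id \<longleftrightarrow> sat N t \<phi>" by (simp add: P_def id_def)
    moreover have "P \<rho> \<longleftrightarrow> sat N (map h t) \<phi>" unfolding P_def h_def ..
    moreover have "P \<rho> \<longleftrightarrow> P id" using tp[OF P] tp[OF dfn_neg[OF P]] by blast
    ultimately show "sat N (map h t) \<phi> \<longleftrightarrow> sat N t \<phi>" by blast
  qed
  moreover have "small L \<kappa> N (A \<union> B)" by (rule small_Un[OF A B])
  ultimately obtain g where g: "automorphism L N g" "\<forall>a\<in>A \<union> B. g a = h a"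
    using homogeneous unfolding strongly_homogeneous_def small_def by blast
  \<comment> \<open>For \<open>b\<close> in both sets, the predicate equating the variable
    \<open>b\<close> with the parameter \<open>b\<close> holds at \<open>id\<close>, hence at
    \<open>\<rho>\<close>.\<close>
  have "h b = b" if b: "b \<in> B" for b
  proof (cases "b \<in> A")
    case True
    then have "dfn sort_of A B (\<lambda>\<sigma>. \<sigma> b = b)" using b Be by (intro dfn_eq_param) auto
    then show ?thesis using tp[of "\<lambda>\<sigma>. \<sigma> b = b"] True by (simp add: h_def)
  qed (simp add: h_def)
  then show ?thesis using g by (intro that[of g]) (auto simp: h_def)
qed

lemma thorn_indep_iff_no_thorn_forks:
  assumes A: "small L \<kappa> N A" and B: "small L \<kappa> N B" and C: "small L \<kappa> N C"
  shows "thorn_indep L \<kappa> N A B C \<longleftrightarrow> (\<forall>X Y \<phi> a b. a \<in> tuples N X \<and> set a \<subseteq> A \<and>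
    b \<in> tuples N Y \<and> set b \<subseteq> B \<union> C \<and> \<phi> \<in> Fm L (X @ Y) \<and> sat N (a @ b) \<phi> \<longrightarrow>
    \<not> thorn_forks L N X Y \<phi> b C)"
proof (intro iffI allI impI)
  fix X Y \<phi> a b
  assume "thorn_indep L \<kappa> N A B C" and "a \<in> tuples N X \<and> set a \<subseteq> A \<and>
    b \<in> tuples N Y \<and> set b \<subseteq> B \<union> C \<and> \<phi> \<in> Fm L (X @ Y) \<and> sat N (a @ b) \<phi>"
  then show "\<not> thorn_forks L N X Y \<phi> b C" using thorn_indep_imp_not_thorn_forks[OF _ B C, of A a X b Y \<phi>] by simp
next
  assume nofork: "\<forall>X Y \<phi> a b. a \<in> tuples N X \<and> set a \<subseteq> A \<and>
    b \<in> tuples N Y \<and> set b \<subseteq> B \<union> C \<and> \<phi> \<in> Fm L (X @ Y) \<and> sat N (a @ b) \<phi> \<longrightarrow>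
    \<not> thorn_forks L N X Y \<phi> b C"
  show "thorn_indep L \<kappa> N A B C"
    unfolding thorn_indep_def
  proof (intro allI impI)
    fix B' assume B': "small L \<kappa> N B' \<and> B \<subseteq> B'"
    \<comment> \<open>This small set contains every parameter tested for M-independence from
      \<open>B'\<close>, as well as the base \<open>B \<union> C\<close> of the type to be
      realised.\<close>
    define D where "D = acl L N (acl L N (B' \<union> C))"
    have B'C: "small L \<kappa> N (B' \<union> C)" using B' C small_Un by blast
    have D: "small L \<kappa> N D" unfolding D_def by (intro small_acl B'C)
    have "B' \<union> C \<subseteq> D"
      using subset_acl[of "B' \<union> C"] subset_acl[OF acl_subset_elems] B'C unfolding D_def small_def by blast
    then have BCD: "B \<union> C \<subseteq> D" using B' by blast
    have BC: "small L \<kappa> N (B \<union> C)" by (rule small_Un[OF B C])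
    have BCe: "B \<union> C \<subseteq> elems L N" using BC by (simp add: small_def)
    obtain \<rho> where \<rho>: "\<rho> \<in> Env sort_of A" "\<And>P. dfn sort_of A (B \<union> C) P \<Longrightarrow> P id \<Longrightarrow> P \<rho>"
      and nodiv: "\<And>a d \<psi>. set a \<subseteq> A \<Longrightarrow> set d \<subseteq> D \<Longrightarrow> \<psi> \<in> Fm L (map sort_of a @ map sort_of d) \<Longrightarrow>
        thorn_divides L N (map sort_of a) (map sort_of d) \<psi> d C \<Longrightarrow> \<not> sat N (map \<rho> a @ d) \<psi>"
      by (rule not_thorn_forks_imp_realisable[OF A BCe D BCD])
        (use nofork in blast, rule that)
    obtain g where g: "automorphism L N g" "\<And>b. b \<in> B \<union> C \<Longrightarrow> g b = b" "\<And>a. a \<in> A \<Longrightarrow> g a = \<rho> a"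
    proof (rule automorphism_extending_assignment[OF A BC \<rho>(1)])
      fix P assume "dfn sort_of A (B \<union> C) P" "P id"
      then show "P \<rho>" by (rule \<rho>(2))
    qed (rule that)
    have Ae: "A \<subseteq> elems L N" using A by (simp add: small_def)
    have sort_\<rho>: "sort_of (\<rho> a) = sort_of a" and \<rho>_elems: "\<rho> a \<in> elems L N" if a: "a \<in> A" for a
    proof -
      have "\<rho> a \<in> carrier N (sort_of a)" "sort_of a \<in> Sorts L"
        using \<rho>(1) a Ae sort_of(1) by (auto simp: Env_def)
      then show "sort_of (\<rho> a) = sort_of a" "\<rho> a \<in> elems L N" using sort_of_eq in_elems by auto
    qed
    have "M_indep L N (\<rho> ` A) B' C"
    proof (rule M_indep_if_no_dividing_formula)
      show "\<rho> ` A \<subseteq> elems L N" using \<rho>_elems by blast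
      show "B' \<subseteq> elems L N" "C \<subseteq> elems L N" using B' C by (auto simp: small_def)
      fix \<psi> a' d
      assume a': "set a' \<subseteq> \<rho> ` A" and d: "set d \<subseteq> acl L N (acl L N (B' \<union> C))"
        and \<psi>: "\<psi> \<in> Fm L (map sort_of a' @ map sort_of d)"
          "thorn_divides L N (map sort_of a') (map sort_of d) \<psi> d C"
      \<comment> \<open>Dividing formulas were excluded for tuples of variables from
        \<open>A\<close>, so \<open>a'\<close> is pulled back along \<open>\<rho>\<close>; sorts are
        preserved by \<open>sort_\<rho>\<close>.\<close>
      define a where "a = map (inv_into A \<rho>) a'"
      have inv: "inv_into A \<rho> x \<in> A \<and> \<rho> (inv_into A \<rho> x) = x" if "x \<in> set a'" for x
        using a' that inv_into_into[of x \<rho> A] f_inv_into_f[of x \<rho> A] by blast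
      have a: "a' = map \<rho> a" "set a \<subseteq> A"
        using inv by (auto simp: a_def comp_def map_idI)
      have eq: "map sort_of a' = map sort_of a" using a sort_\<rho> by auto
      have "set d \<subseteq> D" using d by (simp add: D_def)
      from nodiv[OF a(2) this \<psi>[unfolded eq]] show "\<not> sat N (a' @ d) \<psi>" unfolding a(1) .
    qed
    moreover have "g ` A = \<rho> ` A" using g(3) by auto
    ultimately show "\<exists>A'. conjugate_over L N (B \<union> C) A A' \<and> M_indep L N A' B' C"
      using g(1,2) unfolding conjugate_over_def by (intro exI[of _ "\<rho> ` A"]) blast
  qed
qed

end

section \<open>Application to the language of imaginaries\<close>

lemma is_lang_eq_lang:
  assumes "is_lang L"
  shows "is_lang (eq_lang L T)"
proof -
  have "set ss \<subseteq> Sorts L" if "(ss, E) \<in> eq_rels L T" for ss E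
    using that by (simp add: eq_rels_def Fm_def)
  then show ?thesis using assms unfolding is_lang_def eq_lang_def by (auto intro!: imageI) blast+
qed

theorem propositionA2:
  fixes L :: "('s, 'f, 'r) lang"
    and T :: "('s, 'f, 'r) fm set"
    and \<kappa> :: "'k rel"
    and N :: "(('s, 'f, 'r) eqsort, ('s, 'f, 'r) eqfun, 'r, 'a) struc"
    and A B C :: "'a set"
  defines "Leq \<equiv> eq_lang L T"
  assumes "is_lang L"
    and "complete_theory L T"
    and "consistent L T"
    and "big_saturated_model Leq (eq_theory L T) \<kappa> N"
    and "small Leq \<kappa> N A" and "small Leq \<kappa> N B" and "small Leq \<kappa> N C"
  shows "thorn_indep Leq \<kappa> N A B C \<longleftrightarrow>
    (\<forall>X Y \<phi> a b.
       a \<in> tuples N X \<and> set a \<subseteq> A \<and>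
       b \<in> tuples N Y \<and> set b \<subseteq> B \<union> C \<and>
       \<phi> \<in> Fm Leq (X @ Y) \<and> sat N (a @ b) \<phi> \<longrightarrow>
       \<not> thorn_forks Leq N X Y \<phi> b C)"
proof -
  interpret monster_model Leq \<kappa> N
    using assms(5) is_lang_eq_lang[OF assms(2), of T]
    unfolding monster_model_def big_saturated_model_def is_model_def Leq_def by blast
  show ?thesis by (rule thorn_indep_iff_no_thorn_forks) fact+
qed

end
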